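(* Let $p\geq 1$ and let $(E,d)$ be a separable, locally compact geodesic space. Then for every $\mathbb{P}\in\mathcal{W}_p(\mathcal{W}_p(E))$ there exists a barycenter of $\mathbb{P}$, i.e. a measure \[ \bar\mu_{\mathbb{P}}\in \arg\min_{\nu\in\mathcal{W}_p(E)} \mathbb{E}\big[W_p^p(\nu,\tilde\mu)\big]=\arg\min_{\nu\in\mathcal{W}_p(E)}\int W_p^p(\nu,\mu)\,d\mathbb{P}(\mu), \] where $\tilde\mu$ is a random measure in $\mathcal{W}_p(E)$ with distribution $\mathbb{P}$.
   Context: A geodesic space is a complete metric space $(E,d)$ in which every two points $x,y$ have a mid-point, i.e. a point $z$ with $d(x,z)=d(z,y)=\tfrac12 d(x,y)$. For a metric space $(E,d)$ and $p\geq1$, $\mathcal{W}_p(E)$ denotes the set of Borel probability measures $\mu$ on $E$ with $\int d^p(x,x_0)\,d\mu(x)<\infty$ for some (equivalently any) $x_0\in E$. For $\mu,\nu\in\mathcal{W}_p(E)$, $W_p(\mu,\nu)=\big(\inf_{\pi\in\Gamma(\mu,\nu)}\int d^p(x,y)\,d\pi(x,y)\big)^{1/p}$, where $\Gamma(\mu,\nu)$ is the set of probability measures on $E\times E$ with marginals $\mu$ and $\nu$. $(\mathcal{W}_p(E),W_p)$ is itself a metric space, and $\mathcal{W}_p(\mathcal{W}_p(E))$ denotes the corresponding set of probability measures on $\mathcal{W}_p(E)$ with finite $p$-th moment, equipped with the Wasserstein distance (also denoted $W_p$) built from the metric $W_p$ on $\mathcal{W}_p(E)$. A barycenter of $\mathbb{P}\in\mathcal{W}_p(\mathcal{W}_p(E))$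 is any minimizer over $\nu\in\mathcal{W}_p(E)$ of $\int W_p^p(\nu,\mu)\,d\mathbb{P}(\mu)$ $(=W_p^p(\delta_\nu,\mathbb{P}))$. *)

theory Defs
  imports "HOL-Analysis.Analysis" "HOL-Probability.Probability"
begin

definition borel_of :: "'a topology \<Rightarrow> 'a measure" where
  "borel_of X = sigma (topspace X) {U. openin X U}"

(* geodesic: every two points have a mid-point (completeness comes from the type class) *)
definition geodesic_space :: "'a::metric_space itself \<Rightarrow> bool" where
  "geodesic_space _ \<longleftrightarrow>
     (\<forall>x y::'a. \<exists>z. dist x z = dist x y / 2 \<and> dist z y = dist x y / 2)"

definition Wspace :: "real \<Rightarrow> 'a::metric_space measure set" where
  "Wspace p = {\<mu>. sets \<mu> = sets borel \<and> prob_space \<mu> \<and>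
      (\<exists>x0. (\<integral>\<^sup>+ x. ennreal (dist x x0 powr p) \<partial>\<mu>) < \<infinity>)}"

definition couplings :: "'a::metric_space measure \<Rightarrow> 'a measure \<Rightarrow> ('a \<times> 'a) measure set" where
  "couplings \<mu> \<nu> = {\<pi>. sets \<pi> = sets borel \<and> prob_space \<pi> \<and>
      distr \<pi> borel fst = \<mu> \<and> distr \<pi> borel snd = \<nu>}"

definition Wpp :: "real \<Rightarrow> 'a::metric_space measure \<Rightarrow> 'a measure \<Rightarrow> ennreal" where
  "Wpp p \<mu> \<nu> = (INF \<pi>\<in>couplings \<mu> \<nu>. \<integral>\<^sup>+ z. ennreal (dist (fst z) (snd z) powr p) \<partial>\<pi>)"

definition Wdist :: "real \<Rightarrow> 'a::metric_space measure \<Rightarrow> 'a measure \<Rightarrow> real" where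
  "Wdist p \<mu> \<nu> = enn2real (Wpp p \<mu> \<nu>) powr (1 / p)"

definition WWspace :: "real \<Rightarrow> 'a::metric_space measure measure set" where
  "WWspace p = {P. sets P = sets (borel_of (Metric_space.mtopology (Wspace p) (Wdist p)))
      \<and> prob_space P
      \<and> (\<exists>\<mu>0\<in>Wspace p. (\<integral>\<^sup>+ \<mu>. ennreal (Wdist p \<mu> \<mu>0 powr p) \<partial>P) < \<infinity>)}"

definition barycenter :: "real \<Rightarrow> 'a::metric_space measure measure \<Rightarrow> 'a measure \<Rightarrow> bool" where
  "barycenter p P \<nu> \<longleftrightarrow> \<nu> \<in> Wspace p \<and>
     (\<forall>\<nu>'\<in>Wspace p. (\<integral>\<^sup>+ \<mu>. ennreal (Wdist p \<nu> \<mu> powr p) \<partial>P)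
                       \<le> (\<integral>\<^sup>+ \<mu>. ennreal (Wdist p \<nu>' \<mu> powr p) \<partial>P))"

end

theory Submission
  imports Defs "HOL-Probability.Helly_Selection"
begin

text \<open>
  The direct method: a minimizing sequence has bounded p-th moments, hence is tight because closed
  balls of a complete locally compact geodesic space are compact (Hopf-Rinow). A weak limit point is
  a minimizer, since the transport cost is lower semicontinuous under weak convergence (pass to
  weak limits of near-optimal couplings) and Fatou's lemma applies to the integral over P.

  Prokhorov's theorem is reduced to Helly's selection theorem on the line: a proper space is coded
  by reals so that the code has a continuous inverse on the closure of its range. Measurability of
  the distance to a fixed measure comes from the triangle inequality for the Wasserstein distance,
  proved with approximately glued couplings.
\<close>

section \<open>Proper metric spaces\<close>

text \<open>The weak limit need not be a limit for \<open>Wdist\<close>, because p-th moments may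
  escape to infinity; hence semicontinuity is proved for weak convergence, and the moment bound is
  carried to the limit separately. \<open>P\<close> lives on the Borel sets of the topology of
  \<open>Wdist\<close>, so the metric axioms on \<open>Wspace p\<close> come before any integration:
  they make balls open, hence distances measurable, which Fatou's lemma and additivity of the
  integral over \<open>P\<close> require. The triangle inequality serves a second time, through a
  fixed \<open>\<mu>0\<close> of finite objective, to bound the moments of the minimizing sequence.
  Separability enters as a dense sequence \<open>q\<close>; it makes pairs of measurable maps
  measurable for the Borel sets of the product, where couplings live. Compactness of balls is
  propagated without constructing geodesic curves: iterated mid-points give a point close to
  \<open>y\<close> that is nearer to \<open>x\<close> by a controlled amount, and that
  suffices.\<close>

lemma midpoint_iterate:
  fixes x y :: "'a::metric_space"
  assumes mid: "\<And>x y::'a. \<exists>z. dist x z = dist x y / 2 \<and> dist z y = dist x y / 2"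
  shows "\<exists>z. dist x z \<le> (1 - (1/2)^k) * dist x y \<and> dist z y \<le> (1/2)^k * dist x y"
proof (induction k)
  case 0
  show ?case by (intro exI[of _ x]) auto
next
  case (Suc k)
  then obtain z where z: "dist x z \<le> (1 - (1/2)^k) * dist x y" "dist z y \<le> (1/2)^k * dist x y"
    by blast
  obtain w where w: "dist z w = dist z y / 2" "dist w y = dist z y / 2"
    using mid by blast
  have "dist x w \<le> dist x z + dist z w"
    by (rule dist_triangle)
  also have "\<dots> \<le> (1 - (1/2)^k) * dist x y + ((1/2)^k * dist x y) / 2"
    using z w by linarith
  finally have "dist x w \<le> (1 - (1/2)^Suc k) * dist x y"
    by (simp add: algebra_simps)
  moreover have "dist w y \<le> (1/2)^Suc k * dist x y"
    using z w by simp
  ultimately show ?case by blast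
qed

text \<open>Every point of the large ball is within \<open>(1/2)^k * R\<close> of a concentric ball
  of smaller radius, so a finite e/2-net of that compact ball is an e-net of the large one.
  Completeness turns total boundedness into compactness.\<close>

lemma compact_cball_limit:
  fixes x0 :: "'a::complete_space"
  assumes mid: "\<And>x y::'a. \<exists>z. dist x z = dist x y / 2 \<and> dist z y = dist x y / 2"
    and R: "R > 0" and smaller: "\<And>r. r < R \<Longrightarrow> compact (cball x0 r)"
  shows "compact (cball x0 R)"
  unfolding compact_eq_totally_bounded
proof (intro conjI allI impI)
  show "uniform_space_class.complete (cball x0 R)"
    by (simp add: complete_eq_closed)
next
  fix e :: real assume e: "e > 0"
  obtain k where k: "(1/2)^k < e / 2 / R"
    using real_arch_pow_inv[of "e / 2 / R" "1/2"] e R by auto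
  define r where "r = (1 - (1/2)^k) * R"
  have "r < R" using R by (simp add: r_def algebra_simps)
  then obtain F where F: "finite F" "cball x0 r \<subseteq> (\<Union>x\<in>F. ball x (e/2))"
    using smaller[of r] e unfolding compact_eq_totally_bounded by (meson half_gt_zero)
  have "cball x0 R \<subseteq> (\<Union>x\<in>F. ball x e)"
  proof
    fix y assume y: "y \<in> cball x0 R"
    obtain z where z: "dist x0 z \<le> (1 - (1/2)^k) * dist x0 y" "dist z y \<le> (1/2)^k * dist x0 y"
      using midpoint_iterate[OF mid] by blast
    have "(1 - (1/2)^k) * dist x0 y \<le> r"
      unfolding r_def using y by (intro mult_left_mono) (auto simp: power_le_one)
    then have "z \<in> cball x0 r" using z by auto
    then obtain x where x: "x \<in> F" "dist x z < e/2" using F by auto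
    have "(1/2)^k * dist x0 y \<le> (1/2)^k * R"
      using y by (intro mult_left_mono) auto
    also have "\<dots> < e / 2" using k R by (simp add: field_simps)
    finally have "dist z y < e/2" using z by simp
    then have "dist x y < e" using x dist_triangle[of x y z] by linarith
    then show "y \<in> (\<Union>x\<in>F. ball x e)" using x by auto
  qed
  then show "\<exists>k. finite k \<and> cball x0 R \<subseteq> (\<Union>x\<in>k. ball x e)"
    using F by blast
qed

text \<open>Finitely many compact balls cover the compact ball together with an \<eta>-neighbourhood
  of it. Mid-point iteration places every point of a slightly larger ball in that
  neighbourhood.\<close>

lemma compact_cball_extend:
  fixes x0 :: "'a::metric_space"
  assumes mid: "\<And>x y::'a. \<exists>z. dist x z = dist x y / 2 \<and> dist z y = dist x y / 2"
    and loc: "\<And>x::'a. \<exists>r>0. compact (cball x r)"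
    and R: "R > 0" and comp: "compact (cball x0 R)"
  shows "\<exists>R'>R. compact (cball x0 R')"
proof -
  obtain \<rho> where \<rho>: "\<And>x::'a. \<rho> x > 0" "\<And>x::'a. compact (cball x (\<rho> x))"
    using loc by metis
  have "cball x0 R \<subseteq> (\<Union>x\<in>UNIV. ball x (\<rho> x))"
    by (rule subsetI, rule UN_I[OF UNIV_I], rule iffD2[OF centre_in_ball \<rho>(1)])
  then obtain F where F: "finite F" "cball x0 R \<subseteq> (\<Union>x\<in>F. ball x (\<rho> x))"
    using compactE_image[OF comp, of UNIV "\<lambda>x. ball x (\<rho> x)"] by auto
  define U where "U = (\<Union>x\<in>F. ball x (\<rho> x))"
  have "open U" by (auto simp: U_def)
  have U: "cball x0 R \<subseteq> U" using F by (simp add: U_def)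
  obtain \<eta> where \<eta>0: "\<eta> > 0" "(\<Union>x\<in>cball x0 R. ball x \<eta>) \<subseteq> U"
    using compact_subset_open_imp_ball_epsilon_subset[OF comp \<open>open U\<close> U] by blast
  have \<eta>: "y \<in> U" if "x \<in> cball x0 R" "dist x y < \<eta>" for x y
    using subsetD[OF \<eta>0(2)] that by (meson UN_I mem_ball)
  obtain k where k: "(1/2)^k < min 1 (\<eta> / (R + 1))"
    using real_arch_pow_inv[of "min 1 (\<eta> / (R + 1))" "1/2"] \<eta>0(1) R by auto
  define a :: real where "a = (1/2)^k"
  have a: "0 < a" "a < 1" "a * (R + 1) < \<eta>"
    using k R by (auto simp: a_def field_simps)
  \<comment> \<open>The bound \<open>\<delta> \<le> a * R\<close> gives
    \<open>(1 - a) * (R + \<delta>) \<le> R\<close>, so the intermediate point falls in the old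
    ball; \<open>\<delta> \<le> 1\<close> keeps its distance to \<open>y\<close> below
    \<open>a * (R + 1) < \<eta>\<close>.\<close>
  define \<delta> where "\<delta> = min 1 (a * R)"
  have \<delta>: "0 < \<delta>" "\<delta> \<le> 1" "\<delta> \<le> a * R" using a R by (auto simp: \<delta>_def)
  have "cball x0 (R + \<delta>) \<subseteq> (\<Union>x\<in>F. cball x (\<rho> x))"
  proof
    fix y assume y: "y \<in> cball x0 (R + \<delta>)"
    obtain z where z: "dist x0 z \<le> (1 - a) * dist x0 y" "dist z y \<le> a * dist x0 y"
      using midpoint_iterate[OF mid] unfolding a_def by blast
    have "(1 - a) * dist x0 y \<le> (1 - a) * (R + \<delta>)"
      using y a by (intro mult_left_mono) auto
    also have "\<dots> = R - a * R + \<delta> - a * \<delta>" by (simp add: algebra_simps)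
    also have "\<dots> \<le> R" using \<delta> a mult_nonneg_nonneg[of a \<delta>] by linarith
    finally have "z \<in> cball x0 R" using z by auto
    moreover have "a * dist x0 y \<le> a * (R + 1)"
      using y a \<delta> by (intro mult_left_mono) auto
    then have "dist z y < \<eta>" using z a by linarith
    ultimately have "y \<in> U" using \<eta> by blast
    then show "y \<in> (\<Union>x\<in>F. cball x (\<rho> x))" by (force simp: U_def)
  qed
  then have "cball x0 (R + \<delta>) = cball x0 (R + \<delta>) \<inter> (\<Union>x\<in>F. cball x (\<rho> x))" by auto
  moreover have "compact (\<Union>x\<in>F. cball x (\<rho> x))"
    using F \<rho> by (intro compact_UN) auto
  ultimately have "compact (cball x0 (R + \<delta>))"
    by (metis closed_Int_compact closed_cball)
  then show ?thesis using \<delta>(1) by (intro exI[of _ "R + \<delta>"]) auto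
qed

text \<open>Supremum argument: a non-compact ball bounds the set of good radii. The supremum is
  itself a good radius by \<open>compact_cball_limit\<close> and is then exceeded by
  \<open>compact_cball_extend\<close>.\<close>

lemma geodesic_compact_cball:
  fixes x0 :: "'a::complete_space"
  assumes geo: "geodesic_space TYPE('a)"
    and loc: "locally_compact_space (euclidean :: 'a topology)"
  shows "compact (cball x0 r)"
proof (rule ccontr)
  assume "\<not> compact (cball x0 r)"
  have mid: "\<exists>z. dist x z = dist x y / 2 \<and> dist z y = dist x y / 2" for x y :: 'a
    using geo by (auto simp: geodesic_space_def)
  have sub: "compact (cball x s)" if "compact (cball x t)" "s \<le> t" for x :: 'a and s t
  proof -
    have "cball x s = cball x s \<inter> cball x t" using that by auto
    then show ?thesis using that by (metis closed_Int_compact closed_cball)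
  qed
  have loc': "\<exists>r>0. compact (cball x r)" for x :: 'a
  proof -
    obtain U K where "openin euclidean U" "compactin euclidean K" and UK': "x \<in> U" "U \<subseteq> K"
      using loc unfolding locally_compact_space_def by (metis UNIV_I topspace_euclidean)
    then have UK: "open U" "compact K" "x \<in> U" "U \<subseteq> K" by auto
    then obtain e where e: "e > 0" "cball x e \<subseteq> U"
      by (meson open_contains_cball)
    then have "cball x e = cball x e \<inter> K" using UK by auto
    then have "compact (cball x e)" using UK by (metis closed_Int_compact closed_cball)
    then show ?thesis using e by blast
  qed
  define C where "C = {s. compact (cball x0 s)}"
  have ub: "s \<le> r" if "s \<in> C" for s
    using that sub[of x0 s r] \<open>\<not> compact (cball x0 r)\<close> by (force simp: C_def)
  then have bdd: "bdd_above C" by (auto simp: bdd_above_def)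
  obtain r0 where r0: "r0 > 0" "r0 \<in> C" using loc'[of x0] by (auto simp: C_def)
  define R where "R = Sup C"
  have "R \<ge> r0" unfolding R_def using r0 bdd by (intro cSup_upper)
  then have R: "R > 0" using r0 by simp
  have "compact (cball x0 s)" if s: "s < R" for s
  proof -
    obtain t where "t \<in> C" "s < t"
      using s less_cSup_iff[of C s] r0 bdd unfolding R_def by (metis empty_iff)
    then show ?thesis using sub[of x0 t s] by (auto simp: C_def)
  qed
  then have "compact (cball x0 R)" by (rule compact_cball_limit[OF mid R])
  then obtain R' where "R' > R" "R' \<in> C"
    using compact_cball_extend[OF mid loc' R] by (auto simp: C_def)
  then show False using cSup_upper[OF _ bdd, of R'] by (auto simp: R_def)
qed

section \<open>Coding a proper space by reals\<close>

text \<open>Base 3 with digits 0 and 2 places the codes in the Cantor set, where close codes have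
  equal initial digits. Binary expansions would fail here, since 0.0111... equals 0.1000...\<close>

definition cantor_code :: "(nat \<Rightarrow> bool) \<Rightarrow> real" where
  "cantor_code b = (\<Sum>i. (if b i then 2 else 0) / 3 ^ Suc i)"

lemma summable_cantor_terms:
  "summable (\<lambda>i. (if b i then 2 else 0) / 3 ^ Suc i :: real)"
proof (rule summable_comparison_test')
  show "summable (\<lambda>i. 2 / 3 * (1/3)^i :: real)"
    by (intro summable_mult summable_geometric) auto
  show "norm ((if b i then 2 else 0) / 3 ^ Suc i :: real) \<le> 2/3 * (1/3)^i" if "i \<ge> 0" for i
    by (auto simp: power_one_over divide_simps)
qed

lemma suminf_cantor_terms: "(\<Sum>i. 2 / 3 ^ Suc i :: real) = 1"
proof -
  have "(\<Sum>i. 2 / 3 ^ Suc i :: real) = (\<Sum>i. 2 / 3 * (1/3)^i)"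
    by (auto simp: power_one_over divide_simps)
  also have "\<dots> = 2/3 * (\<Sum>i. (1/3)^i)"
    by (intro suminf_mult summable_geometric) auto
  finally show ?thesis by (simp add: suminf_geometric)
qed

lemma cantor_code_nonneg: "0 \<le> cantor_code b"
  unfolding cantor_code_def by (intro suminf_nonneg summable_cantor_terms) auto

lemma cantor_code_le_1: "cantor_code b \<le> 1"
  unfolding cantor_code_def suminf_cantor_terms[symmetric]
  using summable_cantor_terms[of "\<lambda>_. True"]
  by (intro suminf_le summable_cantor_terms) (auto simp: divide_simps)

text \<open>At the first differing index \<open>j \<le> k\<close> the digits contribute
  \<open>2 / 3^(j+1)\<close>, and everything after \<open>j\<close> can cancel at most half of
  that.\<close>

lemma cantor_code_separated:
  assumes "b k \<noteq> b' k"
  shows "(1/3) ^ Suc k \<le> \<bar>cantor_code b - cantor_code b'\<bar>"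
proof -
  define j where "j = (LEAST j. b j \<noteq> b' j)"
  have j: "b j \<noteq> b' j" unfolding j_def using assms by (rule LeastI)
  have less: "b i = b' i" if "i < j" for i
    using not_less_Least[of i "\<lambda>j. b j \<noteq> b' j"] that unfolding j_def by auto
  have "j \<le> k" unfolding j_def using assms by (rule Least_le)
  define d :: "nat \<Rightarrow> real" where
    "d i = (if b i then 2 else 0) / 3 ^ Suc i - (if b' i then 2 else 0) / 3 ^ Suc i" for i
  have sd: "summable d"
    unfolding d_def by (intro summable_diff summable_cantor_terms)
  have tail: "(\<lambda>i. 2 / 3 ^ Suc (i + Suc j) :: real) sums (1/3) ^ Suc j"
  proof -
    have "(\<lambda>i. 2 / 3 ^ Suc i :: real) sums 1"
      using summable_sums[OF summable_cantor_terms[of "\<lambda>_. True"]] suminf_cantor_terms by simp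
    from sums_mult[OF this, of "(1/3) ^ Suc j"] show ?thesis
      by (simp add: power_add power_one_over divide_simps mult_ac)
  qed
  have dle: "norm (d (i + Suc j)) \<le> 2 / 3 ^ Suc (i + Suc j)" for i
    by (auto simp: d_def)
  have "norm (\<Sum>i. d (i + Suc j)) \<le> (\<Sum>i. 2 / 3 ^ Suc (i + Suc j))"
    by (rule norm_suminf_le[OF dle sums_summable[OF tail]])
  then have T: "\<bar>\<Sum>i. d (i + Suc j)\<bar> \<le> (1/3) ^ Suc j"
    using sums_unique[OF tail] by simp
  have "cantor_code b - cantor_code b' = (\<Sum>i. d i)"
    unfolding cantor_code_def d_def by (intro suminf_diff summable_cantor_terms)
  also have "\<dots> = (\<Sum>i. d (i + Suc j)) + (\<Sum>i<Suc j. d i)"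
    by (rule suminf_split_initial_segment[OF sd])
  also have "(\<Sum>i<Suc j. d i) = d j"
    using less by (simp add: d_def)
  finally have eq: "cantor_code b - cantor_code b' = (\<Sum>i. d (i + Suc j)) + d j" .
  have "\<bar>d j\<bar> = 2 * (1/3) ^ Suc j"
    using j by (auto simp: d_def power_one_over divide_simps)
  then have "(1/3) ^ Suc j \<le> \<bar>cantor_code b - cantor_code b'\<bar>"
    using eq T by linarith
  moreover have "(1/3::real) ^ Suc k \<le> (1/3) ^ Suc j"
    using \<open>j \<le> k\<close> by (intro power_decreasing) auto
  ultimately show ?thesis by linarith
qed

lemma proper_space_code:
  fixes q :: "nat \<Rightarrow> 'b::metric_space" and x0 :: 'b
  assumes proper: "\<And>x r. compact (cball (x::'b) r)"
    and dense: "\<And>x e. e > 0 \<Longrightarrow> \<exists>n. dist x (q n) < e"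
  obtains s :: "'b \<Rightarrow> real" and c :: "real \<Rightarrow> 'b"
  where "s \<in> borel_measurable borel" "continuous_on (closure (range s)) c"
    "\<And>x. c (s x) = x" "\<And>x. 0 \<le> s x" "\<And>x. s x \<le> 2 * dist x x0 + 1"
proof -
  \<comment> \<open>The integer part of the code bounds the distance to \<^term>\<open>x0\<close>; the ternary digits record
    membership in the balls \<^term>\<open>A i\<close>, which form a base. Hence points with convergent codes lie in
    a compact ball and have at most one accumulation point.\<close>
  define A where "A i = ball (q (fst (prod_decode i))) (1 / real (Suc (snd (prod_decode i))))" for i
  define h where "h x = cantor_code (\<lambda>i. x \<in> A i)" for x
  \<comment> \<open>\<open>h\<close> takes values in [0,1], so the factor 2 leaves a gap of length
    at least 1 between codes with different integer parts. Codes closer than 1 therefore share the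
    integer part, and their difference is that of the \<open>h\<close> values.\<close>
  define s where "s x = 2 * real_of_int \<lfloor>dist x x0\<rfloor> + h x" for x
  have h01: "0 \<le> h x" "h x \<le> 1" for x
    unfolding h_def by (rule cantor_code_nonneg cantor_code_le_1)+
  have [measurable]: "h \<in> borel_measurable borel"
    unfolding h_def cantor_code_def
    by (intro borel_measurable_suminf borel_measurable_divide measurable_If borel_measurable_const)
      (simp_all add: A_def borel_open[OF open_ball, unfolded ball_def] del: of_nat_Suc)
  have [measurable]: "(\<lambda>x. dist x x0) \<in> borel_measurable borel"
    by (intro borel_measurable_continuous_onI continuous_intros)
  have s_meas: "s \<in> borel_measurable borel"
    unfolding s_def by measurable
  have s_nonneg: "0 \<le> s x" for x
    using h01[of x] by (simp add: s_def)
  have s_le: "s x \<le> 2 * dist x x0 + 1" for x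
    using h01[of x] of_int_floor_le[of "dist x x0"] unfolding s_def by linarith
  have dist_le: "dist x x0 \<le> s x + 1" for x
    using h01[of x] s_nonneg[of x] unfolding s_def
    using floor_correct[of "dist x x0"] zero_le_floor[of "dist x x0"] zero_le_dist[of x x0]
    by linarith
  have agree: "x \<in> A i \<longleftrightarrow> y \<in> A i" if "\<bar>s x - s y\<bar> < (1/3) ^ Suc i" for x y i
  proof (rule ccontr)
    assume "(x \<in> A i) \<noteq> (y \<in> A i)"
    then have "(1/3) ^ Suc i \<le> \<bar>h x - h y\<bar>"
      unfolding h_def by (rule cantor_code_separated)
    moreover have "(1/3::real) ^ Suc i \<le> 1" by (intro power_le_one) auto
    moreover have "\<lfloor>dist x x0\<rfloor> = \<lfloor>dist y x0\<rfloor>"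
      using that h01[of x] h01[of y] \<open>(1/3::real) ^ Suc i \<le> 1\<close> unfolding s_def by linarith
    ultimately show False using that by (simp add: s_def)
  qed
  \<comment> \<open>\<open>L t l\<close> makes \<open>l\<close> the limit of points whose codes tend
    to \<open>t\<close>, over all such points at once. This single property gives both
    \<open>c (s x) = x\<close> and the continuity of \<open>c\<close>, although \<open>s\<close>
    itself need not be continuous.\<close>
  define L where "L t l \<longleftrightarrow> (\<forall>e>0. \<exists>\<delta>>0. \<forall>x. \<bar>s x - t\<bar> < \<delta> \<longrightarrow> dist x l < e)" for t l
  have ex_L: "\<exists>l. L t l" if t: "t \<in> closure (range s)" for t
  proof -
    from t obtain u where u: "\<And>n. u n \<in> range s" "u \<longlonglongrightarrow> t"
      unfolding closure_sequential by auto
    then obtain x where x: "\<And>n. u n = s (x n)" unfolding image_iff by metis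
    have "u = (\<lambda>n. s (x n))" using x by (rule ext)
    with u have sx: "(\<lambda>n. s (x n)) \<longlonglongrightarrow> t" by simp
    then obtain B where B: "\<And>n. \<bar>s (x n)\<bar> \<le> B"
      using convergent_imp_Bseq[of "\<lambda>n. s (x n)"] unfolding Bseq_def convergent_def by (metis real_norm_def)
    have "x n \<in> cball x0 (B + 1)" for n
      using dist_le[of "x n"] B[of n] by (simp add: dist_commute)
    then obtain l r where l: "strict_mono r" "(x \<circ> r) \<longlonglongrightarrow> l"
      using proper[of x0 "B + 1"] unfolding compact_def by blast
    have sxr: "(\<lambda>n. s (x (r n))) \<longlonglongrightarrow> t"
      using LIMSEQ_subseq_LIMSEQ[OF sx l(1)] by (simp add: o_def)
    \<comment> \<open>A basic ball \<open>A i\<close> of radius below e/2 around a point near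
      \<open>l\<close> contains some \<open>x (r n)\<close> with code near \<open>t\<close>. All
      points with code near \<open>t\<close> have the same digit \<open>i\<close>, so they lie in
      \<open>A i\<close> too.\<close>
    have "L t l" unfolding L_def
    proof (intro allI impI)
      fix e :: real assume e: "e > 0"
      then obtain m where m: "1 / real (Suc m) < e / 2"
        using nat_approx_posE[of "e/2"] by auto
      obtain j where j: "dist l (q j) < 1 / real (Suc m)"
        using dense[of "1 / real (Suc m)" l] by auto
      define i where "i = prod_encode (j, m)"
      have Ai: "A i = ball (q j) (1 / real (Suc m))" by (simp add: A_def i_def)
      \<comment> \<open>Halved because two codes, each within \<delta> of \<open>t\<close>, must be
        within \<open>(1/3) ^ Suc i\<close> of each other.\<close>
      define \<delta> :: real where "\<delta> = (1/3) ^ Suc i / 2"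
      have \<delta>: "\<delta> > 0" by (simp add: \<delta>_def)
      have "\<forall>\<^sub>F n in sequentially. (x \<circ> r) n \<in> A i"
        using j by (intro topological_tendstoD[OF l(2)]) (auto simp: Ai dist_commute)
      moreover have "\<forall>\<^sub>F n in sequentially. dist (s (x (r n))) t < \<delta>"
        using tendstoD[OF sxr \<delta>] .
      ultimately have "\<forall>\<^sub>F n in sequentially. x (r n) \<in> A i \<and> dist (s (x (r n))) t < \<delta>"
        by eventually_elim auto
      then obtain n where n: "x (r n) \<in> A i" "dist (s (x (r n))) t < \<delta>"
        by (auto simp: eventually_sequentially)
      have "dist y l < e" if y: "\<bar>s y - t\<bar> < \<delta>" for y
      proof -
        have "\<bar>s y - s (x (r n))\<bar> < (1/3) ^ Suc i"
          using y n(2) unfolding dist_real_def \<delta>_def by linarith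
        from agree[OF this] n(1) have "y \<in> A i" by blast
        then have "dist (q j) y < 1 / real (Suc m)" by (simp add: Ai)
        then show ?thesis using j m dist_triangle2[of y l "q j"] by (simp add: dist_commute)
      qed
      then show "\<exists>\<delta>>0. \<forall>x. \<bar>s x - t\<bar> < \<delta> \<longrightarrow> dist x l < e" using \<delta> by blast
    qed
    then show ?thesis by blast
  qed
  define c where "c t = (SOME l. L t l)" for t
  have Lc: "L t (c t)" if "t \<in> closure (range s)" for t
    unfolding c_def using ex_L[OF that] by (rule someI_ex)
  have cs: "c (s x) = x" for x
  proof (rule ccontr)
    assume "c (s x) \<noteq> x"
    then have "dist x (c (s x)) > 0" by auto
    moreover have "L (s x) (c (s x))" by (intro Lc) (auto intro: closure_subset[THEN subsetD])
    ultimately obtain \<delta> where "\<delta> > 0" "\<forall>y. \<bar>s y - s x\<bar> < \<delta> \<longrightarrow> dist y (c (s x)) < dist x (c (s x))"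
      unfolding L_def by blast
    then show False by (metis abs_zero diff_self less_irrefl)
  qed
  have cont: "continuous_on (closure (range s)) c"
    unfolding continuous_on_iff
  proof (intro ballI allI impI)
    fix t and e :: real assume t: "t \<in> closure (range s)" and e: "e > 0"
    obtain \<delta> where \<delta>: "\<delta> > 0" "\<And>x. \<bar>s x - t\<bar> < \<delta> \<Longrightarrow> dist x (c t) < e/2"
      using Lc[OF t] e unfolding L_def by (meson half_gt_zero)
    have "dist (c t') (c t) < e" if t': "t' \<in> closure (range s)" "dist t' t < \<delta>" for t'
    proof -
      obtain \<delta>' where \<delta>': "\<delta>' > 0" "\<And>x. \<bar>s x - t'\<bar> < \<delta>' \<Longrightarrow> dist x (c t') < e/2"
        using Lc[OF t'(1)] e unfolding L_def by (meson half_gt_zero)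
      have "min \<delta>' (\<delta> - dist t' t) > 0" using \<delta>' t' by auto
      then obtain x where "dist (s x) t' < min \<delta>' (\<delta> - dist t' t)"
        using t'(1) unfolding closure_approachable by blast
      then have "\<bar>s x - t'\<bar> < \<delta>'" "\<bar>s x - t\<bar> < \<delta>"
        unfolding dist_real_def by linarith+
      then have "dist x (c t') < e/2" "dist x (c t) < e/2" using \<delta> \<delta>' by auto
      then show ?thesis using dist_triangle3[of "c t'" "c t" x] by linarith
    qed
    then show "\<exists>d>0. \<forall>x'\<in>closure (range s). dist x' t < d \<longrightarrow> dist (c x') (c t) < e"
      using \<delta> by blast
  qed
  show ?thesis using that[OF s_meas cont cs s_nonneg s_le] .
qed

section \<open>Prokhorov's theorem on proper spaces\<close>

definition weak_lim :: "(nat \<Rightarrow> 'b::metric_space measure) \<Rightarrow> 'b measure \<Rightarrow> bool" where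
  "weak_lim Ms M \<longleftrightarrow> (\<forall>f::'b \<Rightarrow> real. continuous_on UNIV f \<longrightarrow> (\<exists>B. \<forall>x. \<bar>f x\<bar> \<le> B) \<longrightarrow>
     (\<lambda>n. \<integral>x. f x \<partial>(Ms n)) \<longlonglongrightarrow> (\<integral>x. f x \<partial>M))"

text \<open>Tightness passes to the laws of \<open>s\<close>, because \<open>s\<close> is bounded on
  balls. Helly yields a limit \<open>m\<close> on the line. As \<open>s\<close> is only known to be
  measurable, the limit is brought back through \<open>c\<close>, which is continuous on a closed
  set carrying \<open>m\<close>.\<close>

lemma prokhorov_proper:
  fixes q :: "nat \<Rightarrow> 'b::metric_space" and x0 :: 'b and Ms :: "nat \<Rightarrow> 'b measure"
  assumes proper: "\<And>x r. compact (cball (x::'b) r)"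
    and dense: "\<And>x e. e > 0 \<Longrightarrow> \<exists>n. dist x (q n) < e"
    and prob: "\<And>n. prob_space (Ms n)" and sets: "\<And>n. sets (Ms n) = sets borel"
    and tight: "\<And>\<epsilon>. \<epsilon> > 0 \<Longrightarrow> \<exists>R. \<forall>n. measure (Ms n) (cball x0 R) > 1 - \<epsilon>"
  obtains r M where "strict_mono r" "prob_space M" "sets M = sets borel" "weak_lim (Ms \<circ> r) M"
proof -
  obtain s :: "'b \<Rightarrow> real" and c :: "real \<Rightarrow> 'b" where
    s: "s \<in> borel_measurable borel" and c: "continuous_on (closure (range s)) c"
    and cs: "\<And>x. c (s x) = x" and s_nonneg: "\<And>x. 0 \<le> s x" and s_le: "\<And>x. s x \<le> 2 * dist x x0 + 1"
    using proper_space_code[OF proper dense, of x0] by blast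
  define D where "D = closure (range s)"
  have D: "closed D" by (simp add: D_def)
  have sD: "s x \<in> D" for x unfolding D_def by (auto intro: closure_subset[THEN subsetD])
  define ms where "ms n = distr (Ms n) borel s" for n
  have s_meas: "s \<in> measurable (Ms n) borel" for n
    using s sets[of n] measurable_cong_sets by blast
  have real_ms: "real_distribution (ms n)" for n
    unfolding ms_def real_distribution_def real_distribution_axioms_def
    using prob_space.prob_space_distr[OF prob s_meas] by simp
  have sp: "space (Ms n) = UNIV" for n
    using sets_eq_imp_space_eq[OF sets[of n]] by simp
  have "Helly_Selection.tight ms"
    unfolding tight_def
  proof (intro conjI allI impI real_ms)
    fix \<epsilon> :: real assume "\<epsilon> > 0"
    then obtain R where R: "\<And>n. measure (Ms n) (cball x0 R) > 1 - \<epsilon>"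
      using tight by blast
    \<comment> \<open>The intervals in the definition of tightness are open on the left, so -1
      serves as left end for codes that may equal 0; the maximum ensures \<open>-1 < b\<close> even
      for negative \<open>R\<close>.\<close>
    define b where "b = max 0 (2 * R + 1)"
    have "measure (ms n) {-1<..b} > 1 - \<epsilon>" for n
    proof -
      interpret prob_space "Ms n" by (rule prob)
      have "cball x0 R \<subseteq> s -` {-1<..b} \<inter> space (Ms n)"
        using s_nonneg s_le unfolding b_def sp
        by (fastforce simp: dist_commute intro: less_le_trans[of "-1" 0] order_trans)
      then have "measure (Ms n) (cball x0 R) \<le> measure (Ms n) (s -` {-1<..b} \<inter> space (Ms n))"
        using s_meas[of n] by (intro finite_measure_mono) auto
      then show ?thesis
        unfolding ms_def using R[of n] s_meas[of n] by (simp add: measure_distr)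
    qed
    then show "\<exists>a b. a < b \<and> (\<forall>n. measure (ms n) {a<..b} > 1 - \<epsilon>)"
      by (intro exI[of _ "-1"] exI[of _ b]) (auto simp: b_def)
  qed
  then obtain r m where r: "strict_mono r" and m: "real_distribution m" and
    wc: "weak_conv_m (ms \<circ> id \<circ> r) m"
    using tight_imp_convergent_subsubsequence[of ms id] strict_mono_id by blast
  interpret m: real_distribution m by (rule m)
  have conv: "(\<lambda>n. \<integral>t. g t \<partial>(ms (r n))) \<longlonglongrightarrow> (\<integral>t. g t \<partial>m)"
    if "\<And>x. isCont g x" "\<And>x. norm (g x) \<le> B" for g :: "real \<Rightarrow> real" and B
    using weak_conv_imp_integral_bdd_continuous_conv[OF _ m wc that] real_ms by (simp add: o_def)
  have int_ms: "(\<integral>t. g t \<partial>(ms n)) = (\<integral>x. g (s x) \<partial>(Ms n))" if "g \<in> borel_measurable borel" for g :: "real \<Rightarrow> real" and n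
    unfolding ms_def using that s_meas by (intro integral_distr) auto
  have AE_D: "AE t in m. t \<in> D"
  proof -
    \<comment> \<open>A bounded continuous function that is positive exactly off \<open>D\<close>
      and has integral 0 under every \<open>ms n\<close>. The limit integral is then 0, so
      \<open>m\<close> does not charge the complement of \<open>D\<close>.\<close>
    define g where "g t = min 1 (infdist t D)" for t
    have g_cont: "continuous_on UNIV g"
      unfolding g_def by (intro continuous_intros)
    then have [measurable]: "g \<in> borel_measurable borel" by (rule borel_measurable_continuous_onI)
    have "(\<lambda>n. \<integral>t. g t \<partial>(ms (r n))) \<longlonglongrightarrow> (\<integral>t. g t \<partial>m)"
    proof (rule conv)
      show "isCont g t" for t using g_cont by (simp add: continuous_on_eq_continuous_at)
      show "norm (g t) \<le> 1" for t by (auto simp: g_def infdist_nonneg)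
    qed
    moreover have "(\<integral>t. g t \<partial>(ms (r n))) = 0" for n
      using sD by (subst int_ms) (auto simp: g_def)
    ultimately have "(\<integral>t. g t \<partial>m) = 0"
      using LIMSEQ_unique[OF tendsto_const] by fastforce
    moreover have "integrable m g"
      by (rule m.integrable_const_bound[of _ 1]) (auto simp: g_def infdist_nonneg)
    ultimately have "AE t in m. g t = 0"
      by (subst (asm) integral_nonneg_eq_0_iff_AE) (auto simp: g_def infdist_nonneg)
    then show ?thesis
    proof eventually_elim
      case (elim t)
      then have "infdist t D = 0" by (auto simp: g_def min_def split: if_splits)
      then show ?case using D sD in_closed_iff_infdist_zero by blast
    qed
  qed
  \<comment> \<open>The value \<open>x0\<close> off \<open>D\<close> is arbitrary: it only concerns
    an m-null set and makes \<open>ch\<close> Borel on the whole line.\<close>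
  define ch where "ch t = (if t \<in> D then c t else x0)" for t
  have ch_borel: "ch \<in> measurable borel borel"
  proof (rule borel_measurableI)
    fix S :: "'b set" assume "open S"
    then obtain T where T: "open T" "T \<inter> D = c -` S \<inter> D"
      using c unfolding continuous_on_open_invariant D_def by blast
    have "ch -` S \<inter> space borel = (T \<inter> D) \<union> (if x0 \<in> S then - D else {})"
      unfolding T(2) by (auto simp: ch_def split: if_splits)
    also have "\<dots> \<in> sets borel" using T(1) D by auto
    finally show "ch -` S \<inter> space borel \<in> sets borel" .
  qed
  have ch: "ch \<in> measurable m borel"
    using ch_borel m.events_eq_borel measurable_cong_sets by blast
  define M where "M = distr m borel ch"
  have "prob_space M" unfolding M_def using ch by (rule m.prob_space_distr)
  moreover have "sets M = sets borel" by (simp add: M_def)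
  moreover have "weak_lim (Ms \<circ> r) M"
    unfolding weak_lim_def
  proof (intro allI impI)
    fix f :: "'b \<Rightarrow> real" assume f: "continuous_on UNIV f" and "\<exists>B. \<forall>x. \<bar>f x\<bar> \<le> B"
    then obtain B where B: "\<And>x. \<bar>f x\<bar> \<le> B" by blast
    have B0: "B \<ge> 0" using B[of x0] by linarith
    have f_meas: "f \<in> borel_measurable borel" using f by (rule borel_measurable_continuous_onI)
    \<comment> \<open>Convergence on the line is tested with functions continuous everywhere, so
      \<open>f \<circ> c\<close> is extended from \<open>D\<close> with the same bound. The
      extension agrees with it at every code and m-almost everywhere.\<close>
    have "continuous_on D (f \<circ> c)"
      using c f unfolding D_def by (intro continuous_on_compose) (auto intro: continuous_on_subset)
    then obtain g where g: "continuous_on UNIV g" "\<And>t. t \<in> D \<Longrightarrow> g t = f (c t)" "\<And>t. norm (g t) \<le> B"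
      using Tietze[of D "f \<circ> c" UNIV B] D B0 B by auto
    have g_meas: "g \<in> borel_measurable borel" using g(1) by (rule borel_measurable_continuous_onI)
    have "(\<lambda>n. \<integral>t. g t \<partial>(ms (r n))) \<longlonglongrightarrow> (\<integral>t. g t \<partial>m)"
      using g by (intro conv[of g B]) (auto simp: continuous_on_eq_continuous_at)
    moreover have "(\<integral>t. g t \<partial>(ms n)) = (\<integral>x. f x \<partial>(Ms n))" for n
      using int_ms[OF g_meas] g(2)[OF sD] cs by simp
    moreover have "(\<integral>x. f x \<partial>M) = (\<integral>t. g t \<partial>m)"
    proof -
      have "(\<integral>x. f x \<partial>M) = (\<integral>t. f (ch t) \<partial>m)"
        unfolding M_def using ch f_meas by (rule integral_distr)
      also have "\<dots> = (\<integral>t. g t \<partial>m)"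
      proof (rule integral_cong_AE)
        show "AE t in m. f (ch t) = g t"
          using AE_D by eventually_elim (simp add: ch_def g)
      qed (use measurable_compose[OF ch f_meas] g_meas in auto)
      finally show ?thesis .
    qed
    ultimately show "(\<lambda>n. \<integral>x. f x \<partial>((Ms \<circ> r) n)) \<longlonglongrightarrow> (\<integral>x. f x \<partial>M)" by simp
  qed
  ultimately show ?thesis using that r by blast
qed

section \<open>Couplings\<close>

lemma measurable_fst_borel: "fst \<in> borel_measurable (borel :: ('a::topological_space \<times> 'b::topological_space) measure)"
  by (intro borel_measurable_continuous_onI continuous_intros)

lemma measurable_snd_borel: "snd \<in> borel_measurable (borel :: ('a::topological_space \<times> 'b::topological_space) measure)"
  by (intro borel_measurable_continuous_onI continuous_intros)

text \<open>The library version requires the type class of second countable spaces; here separability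
  is only available as a hypothesis.\<close>

lemma borel_measurable_Pair_dense:
  fixes q :: "nat \<Rightarrow> 'a::metric_space" and q' :: "nat \<Rightarrow> 'b::metric_space"
    and f :: "'c \<Rightarrow> 'a" and g :: "'c \<Rightarrow> 'b"
  assumes dense: "\<And>x e. e > 0 \<Longrightarrow> \<exists>n. dist x (q n) < e"
    and dense': "\<And>x e. e > 0 \<Longrightarrow> \<exists>n. dist x (q' n) < e"
    and f[measurable]: "f \<in> borel_measurable M" and g[measurable]: "g \<in> borel_measurable M"
  shows "(\<lambda>x. (f x, g x)) \<in> borel_measurable M"
proof (rule borel_measurableI)
  fix S :: "('a \<times> 'b) set" assume S: "open S"
  define R where "R i j k = ball (q i) (1 / real (Suc k)) \<times> ball (q' j) (1 / real (Suc k))" for i j k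
  define I where "I = {(i,j,k). R i j k \<subseteq> S}"
  have cover: "\<exists>(i,j,k)\<in>I. (a, b) \<in> R i j k" if ab: "(a, b) \<in> S" for a b
  proof -
    obtain A B where AB: "open A" "open B" "(a, b) \<in> A \<times> B" "A \<times> B \<subseteq> S"
      using open_prod_elim[OF S ab] by metis
    obtain e1 where e1: "e1 > 0" "ball a e1 \<subseteq> A" using AB by (meson SigmaD1 open_contains_ball)
    obtain e2 where e2: "e2 > 0" "ball b e2 \<subseteq> B" using AB by (meson SigmaD2 open_contains_ball)
    have "min e1 e2 / 2 > 0" using e1 e2 by simp
    then obtain k where k: "1 / real (Suc k) < min e1 e2 / 2"
      by (metis nat_approx_posE)
    obtain i where i: "dist a (q i) < 1 / real (Suc k)" using dense[of "1 / real (Suc k)" a] by auto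
    obtain j where j: "dist b (q' j) < 1 / real (Suc k)" using dense'[of "1 / real (Suc k)" b] by auto
    have "ball (q i) (1 / real (Suc k)) \<subseteq> ball a e1"
    proof
      fix t assume "t \<in> ball (q i) (1 / real (Suc k))"
      then show "t \<in> ball a e1"
        using i k dist_triangle[of a t "q i"] unfolding mem_ball by linarith
    qed
    moreover have "ball (q' j) (1 / real (Suc k)) \<subseteq> ball b e2"
    proof
      fix t assume "t \<in> ball (q' j) (1 / real (Suc k))"
      then show "t \<in> ball b e2"
        using j k dist_triangle[of b t "q' j"] unfolding mem_ball by linarith
    qed
    ultimately have "R i j k \<subseteq> S" using e1 e2 AB unfolding R_def by blast
    moreover have "(a, b) \<in> R i j k" using i j by (simp add: R_def dist_commute del: of_nat_Suc)
    ultimately show ?thesis by (auto simp: I_def)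
  qed
  have "(\<lambda>x. (f x, g x)) -` S \<inter> space M =
      (\<Union>(i,j,k)\<in>I. (f -` ball (q i) (1 / real (Suc k)) \<inter> space M) \<inter> (g -` ball (q' j) (1 / real (Suc k)) \<inter> space M))"
    (is "?L = ?R")
  proof (intro equalityI subsetI)
    fix x assume "x \<in> ?L"
    then have x: "x \<in> space M" "(f x, g x) \<in> S" by auto
    obtain i j k where "(i,j,k) \<in> I" "(f x, g x) \<in> R i j k" using cover[OF x(2)] by auto
    then show "x \<in> ?R" using x(1) unfolding R_def by (intro UN_I[of "(i,j,k)"]) auto
  next
    fix x assume "x \<in> ?R"
    then obtain i j k where "(i,j,k) \<in> I" "(f x, g x) \<in> R i j k" "x \<in> space M" unfolding R_def by auto
    then show "x \<in> ?L" unfolding I_def by auto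
  qed
  also have "\<dots> \<in> sets M"
    by (intro sets.countable_UN'[OF countableI_type] image_subsetI)
      (auto intro!: sets.Int measurable_sets[OF f] measurable_sets[OF g])
  finally show "?L \<in> sets M" .
qed

section \<open>Transport cost and symmetry of the Wasserstein distance\<close>

definition tcost :: "real \<Rightarrow> ('a::metric_space \<times> 'a) measure \<Rightarrow> ennreal" where
  "tcost p \<pi> = (\<integral>\<^sup>+ z. ennreal (dist (fst z) (snd z) powr p) \<partial>\<pi>)"

lemma Wpp_tcost: "Wpp p \<mu> \<nu> = (INF \<pi>\<in>couplings \<mu> \<nu>. tcost p \<pi>)"
  by (simp add: Wpp_def tcost_def)

lemma Wpp_le_tcost: "\<pi> \<in> couplings \<mu> \<nu> \<Longrightarrow> Wpp p \<mu> \<nu> \<le> tcost p \<pi>"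
  unfolding Wpp_tcost by (rule INF_lower)

lemma borel_measurable_dist_powr:
  "(\<lambda>z. dist (fst z) (snd z) powr p) \<in> borel_measurable (borel :: ('a::metric_space \<times> 'a) measure)"
proof -
  have [measurable]: "(\<lambda>z. dist (fst z) (snd z)) \<in> borel_measurable (borel :: ('a \<times> 'a) measure)"
    by (intro borel_measurable_continuous_onI continuous_intros)
  show ?thesis by measurable
qed

lemma couplingsD:
  assumes "\<pi> \<in> couplings \<mu> \<nu>"
  shows "sets \<pi> = sets borel" "prob_space \<pi>" "distr \<pi> borel fst = \<mu>" "distr \<pi> borel snd = \<nu>"
    "fst \<in> borel_measurable \<pi>" "snd \<in> borel_measurable \<pi>"
  using assms measurable_fst_borel measurable_snd_borel
  by (auto simp: couplings_def cong: measurable_cong_sets)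

lemma nn_integral_coupling:
  assumes "\<pi> \<in> couplings \<mu> \<nu>" "f \<in> borel_measurable borel"
  shows "(\<integral>\<^sup>+ z. f (fst z) \<partial>\<pi>) = (\<integral>\<^sup>+ x. f x \<partial>\<mu>)" "(\<integral>\<^sup>+ z. f (snd z) \<partial>\<pi>) = (\<integral>\<^sup>+ x. f x \<partial>\<nu>)"
  using couplingsD[OF assms(1)] assms(2)
    nn_integral_distr[of fst \<pi> borel f] nn_integral_distr[of snd \<pi> borel f] by auto

lemma borel_measurable_swap:
  "prod.swap \<in> measurable (borel :: ('a::topological_space \<times> 'b::topological_space) measure) borel"
  unfolding prod.swap_def by (intro borel_measurable_continuous_onI continuous_intros)

lemma Wpp_commute_le: "Wpp p \<nu> \<mu> \<le> Wpp p \<mu> (\<nu> :: 'a::metric_space measure)"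
  unfolding Wpp_tcost[of p \<mu>]
proof (rule INF_greatest)
  fix \<pi> assume \<pi>: "\<pi> \<in> couplings \<mu> \<nu>"
  note D = couplingsD[OF \<pi>]
  have sw: "prod.swap \<in> measurable \<pi> borel"
    using borel_measurable_swap D(1) by (simp cong: measurable_cong_sets)
  define \<pi>' where "\<pi>' = distr \<pi> borel prod.swap"
  have "distr \<pi>' borel fst = \<nu>" "distr \<pi>' borel snd = \<mu>"
    unfolding \<pi>'_def using D sw
    by (subst distr_distr; simp add: measurable_fst_borel measurable_snd_borel comp_def)+
  moreover have "prob_space \<pi>'"
    unfolding \<pi>'_def using D(2) sw by (rule prob_space.prob_space_distr)
  ultimately have "\<pi>' \<in> couplings \<nu> \<mu>" by (simp add: couplings_def \<pi>'_def)
  moreover have "tcost p \<pi>' = tcost p \<pi>"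
    unfolding tcost_def \<pi>'_def using sw borel_measurable_dist_powr[of p]
    by (subst nn_integral_distr) (auto simp: dist_commute)
  ultimately show "Wpp p \<nu> \<mu> \<le> tcost p \<pi>" using Wpp_le_tcost by metis
qed

lemma Wpp_commute: "Wpp p \<mu> \<nu> = Wpp p \<nu> (\<mu> :: 'a::metric_space measure)"
  by (intro antisym Wpp_commute_le)

lemma Wdist_commute: "Wdist p \<mu> \<nu> = Wdist p \<nu> (\<mu> :: 'a::metric_space measure)"
  unfolding Wdist_def by (simp add: Wpp_commute)

lemma Wdist_nonneg: "0 \<le> Wdist p \<mu> \<nu>"
  by (simp add: Wdist_def)

section \<open>Moments of order p\<close>

lemma powr_add_le:
  fixes a b p :: real
  assumes "a \<ge> 0" "b \<ge> 0" "p \<ge> 0"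
  shows "(a + b) powr p \<le> 2 powr p * (a powr p + b powr p)"
proof -
  have "(a + b) powr p \<le> (2 * max a b) powr p"
    using assms by (intro powr_mono2) auto
  also have "\<dots> = 2 powr p * max a b powr p"
    using assms by (simp add: powr_mult)
  also have "max a b powr p \<le> a powr p + b powr p"
    by (auto simp: max_def)
  finally show ?thesis by simp
qed

lemma dist_powr_le:
  fixes x y z :: "'a::metric_space"
  assumes "p \<ge> 0"
  shows "dist x y powr p \<le> 2 powr p * (dist x z powr p + dist y z powr p)"
proof -
  have "dist x y powr p \<le> (dist x z + dist y z) powr p"
    using assms by (intro powr_mono2) (auto intro: dist_triangle2)
  also have "\<dots> \<le> 2 powr p * (dist x z powr p + dist y z powr p)"
    using assms by (intro powr_add_le) auto
  finally show ?thesis .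
qed

lemma borel_measurable_dist_const_powr:
  "(\<lambda>x. dist x (z::'a::metric_space) powr p) \<in> borel_measurable borel"
proof -
  have [measurable]: "(\<lambda>x. dist x z) \<in> borel_measurable borel"
    by (intro borel_measurable_continuous_onI continuous_intros)
  show ?thesis by measurable
qed

definition moment :: "real \<Rightarrow> 'a::metric_space \<Rightarrow> 'a measure \<Rightarrow> ennreal" where
  "moment p x0 \<mu> = (\<integral>\<^sup>+ x. ennreal (dist x x0 powr p) \<partial>\<mu>)"

text \<open>Membership supplies finiteness at some base point; \<open>dist_powr_le\<close> moves it
  to an arbitrary \<open>x0\<close>, since a constant has finite integral under a probability
  measure.\<close>

lemma WspaceD:
  assumes "\<mu> \<in> Wspace p" "p \<ge> 0"
  shows "sets \<mu> = sets borel" "prob_space \<mu>" "moment p x0 \<mu> < \<infinity>"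
proof -
  show s: "sets \<mu> = sets borel" and pr: "prob_space \<mu>" using assms by (auto simp: Wspace_def)
  obtain y where y: "moment p y \<mu> < \<infinity>" using assms by (auto simp: Wspace_def moment_def)
  interpret prob_space \<mu> by fact
  have m[measurable]: "(\<lambda>x. dist x z powr p) \<in> borel_measurable \<mu>" for z
    using borel_measurable_dist_const_powr[of z p] s by (simp cong: measurable_cong_sets)
  have "moment p x0 \<mu> \<le> (\<integral>\<^sup>+ x. ennreal (2 powr p) * (ennreal (dist x y powr p) + ennreal (dist x0 y powr p)) \<partial>\<mu>)"
    unfolding moment_def using dist_powr_le[OF assms(2)]
    by (intro nn_integral_mono) (simp flip: ennreal_mult ennreal_plus)
  also have "\<dots> = ennreal (2 powr p) * (moment p y \<mu> + ennreal (dist x0 y powr p))"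
    unfolding moment_def by (simp add: nn_integral_cmult nn_integral_add emeasure_space_1)
  also have "\<dots> < \<infinity>" using y by (simp add: ennreal_mult_less_top less_top)
  finally show "moment p x0 \<mu> < \<infinity>" .
qed

lemma WspaceI:
  assumes "sets \<mu> = sets borel" "prob_space \<mu>" "moment p x0 \<mu> < \<infinity>"
  shows "\<mu> \<in> Wspace p"
  using assms by (auto simp: Wspace_def moment_def)

text \<open>Approximate gluing: the conditional laws of the two couplings given the middle point are
  replaced by conditioning on a small cell of a countable partition; this
  avoids disintegration.\<close>

lemma approximate_gluing:
  fixes q :: "nat \<Rightarrow> 'a::metric_space" and \<mu> \<nu> \<rho> :: "'a measure"
  assumes dense: "\<And>x e. e > 0 \<Longrightarrow> \<exists>n. dist x (q n) < e"
    and \<pi>1: "\<pi>1 \<in> couplings \<mu> \<nu>" and \<pi>2: "\<pi>2 \<in> couplings \<nu> \<rho>"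
    and \<epsilon>: "\<epsilon> > 0" and nonneg: "A \<ge> 0" "B \<ge> 0" "C \<ge> 0"
    and ineq: "\<And>x y y' z :: 'a. dist y y' < \<epsilon> \<Longrightarrow>
        dist x z powr p \<le> A * dist x y powr p + B + C * dist y' z powr p"
  shows "\<exists>\<pi>\<in>couplings \<mu> \<rho>. tcost p \<pi> \<le> ennreal A * tcost p \<pi>1 + ennreal B + ennreal C * tcost p \<pi>2"
proof -
  note D1 = couplingsD[OF \<pi>1] and D2 = couplingsD[OF \<pi>2]
  interpret pi1: prob_space \<pi>1 by (rule D1)
  interpret pi2: prob_space \<pi>2 by (rule D2)
  interpret PP: pair_prob_space \<pi>1 \<pi>2 by standard
  have sp[simp]: "space \<pi>1 = UNIV" "space \<pi>2 = UNIV"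
    using sets_eq_imp_space_eq[OF D1(1)] sets_eq_imp_space_eq[OF D2(1)] by simp_all
  have \<nu>: "sets \<nu> = sets borel"
    using sets_distr[of \<pi>1 borel snd] unfolding D1(4) .
  have "prob_space \<nu>"
    using pi1.prob_space_distr[OF D1(6)] unfolding D1(4) .
  then interpret nu: prob_space \<nu> .
  \<comment> \<open>The cells \<open>idx y = i\<close> form a countable Borel partition. Two points
    of one cell share a dense point within \<epsilon>/2 and so are less than \<epsilon>
    apart.\<close>
  define idx where "idx y = (LEAST j. dist y (q j) < \<epsilon> / 2)" for y
  have idx_dist: "dist y (q (idx y)) < \<epsilon> / 2" for y
    unfolding idx_def by (rule LeastI_ex, rule dense) (use \<epsilon> in simp)
  have "{y. dist y (q j) < \<epsilon> / 2} \<in> sets borel" for j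
    by (intro borel_open open_Collect_less continuous_intros)
  then have idx_meas[measurable]: "idx \<in> measurable borel (count_space UNIV)"
    unfolding idx_def by (intro measurable_Least) (simp only: pred_def space_borel UNIV_I simp_thms)
  define w where "w i = measure \<nu> {y. idx y = i}" for i
  have idx_set: "{y. idx y = i} \<in> sets borel" for i
    using measurable_sets[OF idx_meas, of "{i}"] by (simp add: vimage_def)
  have w1: "emeasure \<pi>1 {z. idx (snd z) = i} = ennreal (w i)" for i
  proof -
    have "emeasure \<nu> {y. idx y = i} = emeasure \<pi>1 (snd -` {y. idx y = i} \<inter> space \<pi>1)"
      unfolding D1(4)[symmetric] using idx_set D1(6) by (intro emeasure_distr) auto
    then show ?thesis by (simp add: w_def nu.emeasure_eq_measure vimage_def)
  qed
  have w2: "emeasure \<pi>2 {z. idx (fst z) = i} = ennreal (w i)" for i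
  proof -
    have "emeasure \<nu> {y. idx y = i} = emeasure \<pi>2 (fst -` {y. idx y = i} \<inter> space \<pi>2)"
      unfolding D2(3)[symmetric] using idx_set D2(5) by (intro emeasure_distr) auto
    then show ?thesis by (simp add: w_def nu.emeasure_eq_measure vimage_def)
  qed
  have AE_w: "AE y in \<nu>. w (idx y) \<noteq> 0"
  proof -
    have "AE y in \<nu>. idx y = i \<longrightarrow> w i \<noteq> 0" for i
    proof (cases "w i = 0")
      case True
      have "AE y in \<nu>. y \<notin> {y. idx y = i}"
        using True idx_set \<nu> by (intro AE_not_in) (auto simp: null_sets_def nu.emeasure_eq_measure w_def)
      then show ?thesis by eventually_elim simp
    qed auto
    then have "AE y in \<nu>. \<forall>i. idx y = i \<longrightarrow> w i \<noteq> 0"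
      by (intro AE_all_countable[THEN iffD2] allI)
    then show ?thesis by eventually_elim auto
  qed
  have AE1: "AE z in \<pi>1. w (idx (snd z)) \<noteq> 0"
    using AE_w unfolding D1(4)[symmetric] by (rule AE_distrD[OF D1(6)])
  have AE2: "AE z in \<pi>2. w (idx (fst z)) \<noteq> 0"
    using AE_w unfolding D2(3)[symmetric] by (rule AE_distrD[OF D2(5)])
  \<comment> \<open>Density of the glued law with respect to the independent product: both middle
    points must lie in one cell, and \<open>1 / w\<close> normalizes by the mass of that cell. On
    cells of mass 0 the quotient is 0, which \<open>AE1\<close> and \<open>AE2\<close> make
    harmless.\<close>
  define g :: "('a \<times> 'a) \<times> ('a \<times> 'a) \<Rightarrow> ennreal" where
    "g u = (if idx (snd (fst u)) = idx (fst (snd u)) then ennreal (1 / w (idx (snd (fst u)))) else 0)" for u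
  have i1: "(\<lambda>z. idx (snd z)) \<in> measurable \<pi>1 (count_space UNIV)"
    and i2: "(\<lambda>z. idx (fst z)) \<in> measurable \<pi>2 (count_space UNIV)"
    using measurable_compose[OF D1(6) idx_meas] measurable_compose[OF D2(5) idx_meas] by auto
  have j1: "(\<lambda>u. idx (snd (fst u))) \<in> measurable (\<pi>1 \<Otimes>\<^sub>M \<pi>2) (count_space UNIV)"
    and j2: "(\<lambda>u. idx (fst (snd u))) \<in> measurable (\<pi>1 \<Otimes>\<^sub>M \<pi>2) (count_space UNIV)"
    using measurable_compose[OF measurable_fst i1] measurable_compose[OF measurable_snd i2] by auto
  have "{u \<in> space (\<pi>1 \<Otimes>\<^sub>M \<pi>2). idx (snd (fst u)) = idx (fst (snd u))} =
      (\<Union>i. ((\<lambda>u. idx (snd (fst u))) -` {i} \<inter> space (\<pi>1 \<Otimes>\<^sub>M \<pi>2)) \<inter>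
           ((\<lambda>u. idx (fst (snd u))) -` {i} \<inter> space (\<pi>1 \<Otimes>\<^sub>M \<pi>2)))" by auto
  also have "\<dots> \<in> sets (\<pi>1 \<Otimes>\<^sub>M \<pi>2)"
    by (intro sets.countable_UN image_subsetI sets.Int measurable_sets[OF j1] measurable_sets[OF j2])
      simp_all
  finally have eq_set: "{u \<in> space (\<pi>1 \<Otimes>\<^sub>M \<pi>2). idx (snd (fst u)) = idx (fst (snd u))} \<in> sets (\<pi>1 \<Otimes>\<^sub>M \<pi>2)" .
  have "(\<lambda>i. ennreal (1 / w i)) \<in> borel_measurable (count_space UNIV)" by simp
  then have g_meas[measurable]: "g \<in> borel_measurable (\<pi>1 \<Otimes>\<^sub>M \<pi>2)"
    unfolding g_def by (intro measurable_If eq_set measurable_compose[OF j1] borel_measurable_const)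
  have set1: "{z. idx (snd z) = i} \<in> sets \<pi>1" for i
    using measurable_sets[OF i1, of "{i}"] by (simp add: vimage_def)
  have set2: "{z. idx (fst z) = i} \<in> sets \<pi>2" for i
    using measurable_sets[OF i2, of "{i}"] by (simp add: vimage_def)
  have inner2: "(\<integral>\<^sup>+ z2. g (z1, z2) \<partial>\<pi>2) = 1" if "w (idx (snd z1)) \<noteq> 0" for z1
  proof -
    let ?i = "idx (snd z1)"
    have "w ?i > 0" using that by (simp add: w_def zero_less_measure_iff)
    have "(\<integral>\<^sup>+ z2. g (z1, z2) \<partial>\<pi>2) = (\<integral>\<^sup>+ z2. ennreal (1 / w ?i) * indicator {z. idx (fst z) = ?i} z2 \<partial>\<pi>2)"
      by (intro nn_integral_cong) (auto simp: g_def indicator_def)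
    also have "\<dots> = ennreal (1 / w ?i) * ennreal (w ?i)"
      using set2 by (simp add: nn_integral_cmult_indicator w2)
    also have "\<dots> = 1" using \<open>w ?i > 0\<close> by (simp flip: ennreal_mult)
    finally show ?thesis .
  qed
  have inner1: "(\<integral>\<^sup>+ z1. g (z1, z2) \<partial>\<pi>1) = 1" if "w (idx (fst z2)) \<noteq> 0" for z2
  proof -
    let ?i = "idx (fst z2)"
    have "w ?i > 0" using that by (simp add: w_def zero_less_measure_iff)
    have "(\<integral>\<^sup>+ z1. g (z1, z2) \<partial>\<pi>1) = (\<integral>\<^sup>+ z1. ennreal (1 / w ?i) * indicator {z. idx (snd z) = ?i} z1 \<partial>\<pi>1)"
      by (intro nn_integral_cong) (auto simp: g_def indicator_def)
    also have "\<dots> = ennreal (1 / w ?i) * ennreal (w ?i)"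
      using set1 by (simp add: nn_integral_cmult_indicator w1)
    also have "\<dots> = 1" using \<open>w ?i > 0\<close> by (simp flip: ennreal_mult)
    finally show ?thesis .
  qed
  \<comment> \<open>Under \<open>Q\<close> the two pairs have laws \<open>\<pi>1\<close> and
    \<open>\<pi>2\<close>, because integrating \<open>g\<close> over either factor gives 1 almost
    everywhere. The two middle points need not coincide, but they share a cell.\<close>
  define Q where "Q = density (\<pi>1 \<Otimes>\<^sub>M \<pi>2) g"
  have Qsets[measurable_cong]: "sets Q = sets (\<pi>1 \<Otimes>\<^sub>M \<pi>2)" by (simp add: Q_def)
  have Q1: "distr Q \<pi>1 fst = \<pi>1"
  proof (rule measure_eqI)
    fix S assume "S \<in> sets (distr Q \<pi>1 fst)"
    then have S[measurable]: "S \<in> sets \<pi>1" by simp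
    have "emeasure (distr Q \<pi>1 fst) S = (\<integral>\<^sup>+ z. indicator S z \<partial>distr Q \<pi>1 fst)" by simp
    also have "\<dots> = (\<integral>\<^sup>+ u. indicator S (fst u) \<partial>Q)"
      by (subst nn_integral_distr) (auto simp del: nn_integral_indicator)
    also have "\<dots> = (\<integral>\<^sup>+ u. g u * indicator S (fst u) \<partial>(\<pi>1 \<Otimes>\<^sub>M \<pi>2))"
      unfolding Q_def by (subst nn_integral_density) auto
    also have "\<dots> = (\<integral>\<^sup>+ z1. \<integral>\<^sup>+ z2. g (z1, z2) * indicator S z1 \<partial>\<pi>2 \<partial>\<pi>1)"
      by (subst pi2.nn_integral_fst[symmetric]) auto
    also have "\<dots> = (\<integral>\<^sup>+ z1. (\<integral>\<^sup>+ z2. g (z1, z2) \<partial>\<pi>2) * indicator S z1 \<partial>\<pi>1)"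
      by (intro nn_integral_cong nn_integral_multc) auto
    also have "\<dots> = (\<integral>\<^sup>+ z1. indicator S z1 \<partial>\<pi>1)"
      using AE1 by (intro nn_integral_cong_AE) (auto simp: inner2)
    finally show "emeasure (distr Q \<pi>1 fst) S = emeasure \<pi>1 S" by simp
  qed simp
  have Q2: "distr Q \<pi>2 snd = \<pi>2"
  proof (rule measure_eqI)
    fix S assume "S \<in> sets (distr Q \<pi>2 snd)"
    then have S[measurable]: "S \<in> sets \<pi>2" by simp
    have "emeasure (distr Q \<pi>2 snd) S = (\<integral>\<^sup>+ z. indicator S z \<partial>distr Q \<pi>2 snd)" by simp
    also have "\<dots> = (\<integral>\<^sup>+ u. indicator S (snd u) \<partial>Q)"
      by (subst nn_integral_distr) (auto simp del: nn_integral_indicator)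
    also have "\<dots> = (\<integral>\<^sup>+ u. g u * indicator S (snd u) \<partial>(\<pi>1 \<Otimes>\<^sub>M \<pi>2))"
      unfolding Q_def by (subst nn_integral_density) auto
    also have "\<dots> = (\<integral>\<^sup>+ z2. \<integral>\<^sup>+ z1. g (z1, z2) * indicator S z2 \<partial>\<pi>1 \<partial>\<pi>2)"
      by (subst PP.nn_integral_snd[symmetric]) auto
    also have "\<dots> = (\<integral>\<^sup>+ z2. (\<integral>\<^sup>+ z1. g (z1, z2) \<partial>\<pi>1) * indicator S z2 \<partial>\<pi>2)"
      by (intro nn_integral_cong nn_integral_multc) auto
    also have "\<dots> = (\<integral>\<^sup>+ z2. indicator S z2 \<partial>\<pi>2)"
      using AE2 by (intro nn_integral_cong_AE) (auto simp: inner1)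
    finally show "emeasure (distr Q \<pi>2 snd) S = emeasure \<pi>2 S" by simp
  qed simp
  have fstQ[measurable]: "fst \<in> measurable Q \<pi>1" and sndQ[measurable]: "snd \<in> measurable Q \<pi>2"
    by measurable
  \<comment> \<open>The total mass of \<open>Q\<close> is read off from its image
    \<open>\<pi>1\<close>.\<close>
  interpret Q: prob_space Q
    using prob_space_distrD[OF fstQ] Q1 D1(2) by simp
  define \<pi> where "\<pi> = distr Q borel (\<lambda>u. (fst (fst u), snd (snd u)))"
  have h: "(\<lambda>u. (fst (fst u), snd (snd u))) \<in> borel_measurable Q"
    by (intro borel_measurable_Pair_dense[OF dense dense]
        measurable_compose[OF fstQ D1(5)] measurable_compose[OF sndQ D2(6)])
  have "distr \<pi> borel fst = distr Q borel (\<lambda>u. fst (fst u))"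
    unfolding \<pi>_def using h by (subst distr_distr) (auto simp: measurable_fst_borel comp_def)
  also have "\<dots> = distr (distr Q \<pi>1 fst) borel fst"
    by (subst distr_distr[OF D1(5) fstQ]) (simp add: comp_def)
  finally have m1: "distr \<pi> borel fst = \<mu>" using Q1 D1(3) by simp
  have "distr \<pi> borel snd = distr Q borel (\<lambda>u. snd (snd u))"
    unfolding \<pi>_def using h by (subst distr_distr) (auto simp: measurable_snd_borel comp_def)
  also have "\<dots> = distr (distr Q \<pi>2 snd) borel snd"
    by (subst distr_distr[OF D2(6) sndQ]) (simp add: comp_def)
  finally have m2: "distr \<pi> borel snd = \<rho>" using Q2 D2(4) by simp
  have "prob_space \<pi>" unfolding \<pi>_def using h by (rule Q.prob_space_distr)
  then have coup: "\<pi> \<in> couplings \<mu> \<rho>" using m1 m2 by (simp add: couplings_def \<pi>_def)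
  have d1[measurable]: "(\<lambda>z. dist (fst z) (snd z) powr p) \<in> borel_measurable \<pi>1"
    and d2[measurable]: "(\<lambda>z. dist (fst z) (snd z) powr p) \<in> borel_measurable \<pi>2"
    using borel_measurable_dist_powr[of p, where 'a='a] D1(1) D2(1) by (simp_all cong: measurable_cong_sets)
  have close: "AE u in Q. dist (snd (fst u)) (fst (snd u)) < \<epsilon>"
    unfolding Q_def
  proof (subst AE_density[OF g_meas], rule AE_I2, rule impI)
    fix u assume "0 < g u"
    then have "idx (snd (fst u)) = idx (fst (snd u))" by (auto simp: g_def split: if_splits)
    then show "dist (snd (fst u)) (fst (snd u)) < \<epsilon>"
      using idx_dist[of "snd (fst u)"] idx_dist[of "fst (snd u)"]
        dist_triangle2[of "snd (fst u)" "fst (snd u)" "q (idx (fst (snd u)))"] by simp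
  qed
  have "tcost p \<pi> = (\<integral>\<^sup>+ u. ennreal (dist (fst (fst u)) (snd (snd u)) powr p) \<partial>Q)"
    unfolding tcost_def \<pi>_def using h borel_measurable_dist_powr[of p, where 'a='a]
    by (subst nn_integral_distr) auto
  also have "\<dots> \<le> (\<integral>\<^sup>+ u. ennreal A * ennreal (dist (fst (fst u)) (snd (fst u)) powr p) + ennreal B
      + ennreal C * ennreal (dist (fst (snd u)) (snd (snd u)) powr p) \<partial>Q)"
  proof (rule nn_integral_mono_AE)
    show "AE u in Q. ennreal (dist (fst (fst u)) (snd (snd u)) powr p) \<le>
        ennreal A * ennreal (dist (fst (fst u)) (snd (fst u)) powr p) + ennreal B
      + ennreal C * ennreal (dist (fst (snd u)) (snd (snd u)) powr p)"
      using close
    proof eventually_elim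
      case (elim u)
      from ineq[OF this, of "fst (fst u)" "snd (snd u)"] show ?case
        using nonneg by (simp flip: ennreal_mult ennreal_plus)
    qed
  qed
  also have "\<dots> = ennreal A * (\<integral>\<^sup>+ u. ennreal (dist (fst (fst u)) (snd (fst u)) powr p) \<partial>Q) + ennreal B
      + ennreal C * (\<integral>\<^sup>+ u. ennreal (dist (fst (snd u)) (snd (snd u)) powr p) \<partial>Q)"
  proof -
    have [measurable]: "(\<lambda>u. dist (fst (fst u)) (snd (fst u)) powr p) \<in> borel_measurable Q"
      "(\<lambda>u. dist (fst (snd u)) (snd (snd u)) powr p) \<in> borel_measurable Q"
      using measurable_compose[OF fstQ d1] measurable_compose[OF sndQ d2] by auto
    show ?thesis
      by (simp add: nn_integral_add nn_integral_cmult Q.emeasure_space_1)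
  qed
  also have "(\<integral>\<^sup>+ u. ennreal (dist (fst (fst u)) (snd (fst u)) powr p) \<partial>Q) = tcost p \<pi>1"
    using nn_integral_distr[OF fstQ, of "\<lambda>z. ennreal (dist (fst z) (snd z) powr p)"]
    by (simp add: Q1 tcost_def)
  also have "(\<integral>\<^sup>+ u. ennreal (dist (fst (snd u)) (snd (snd u)) powr p) \<partial>Q) = tcost p \<pi>2"
    using nn_integral_distr[OF sndQ, of "\<lambda>z. ennreal (dist (fst z) (snd z) powr p)"]
    by (simp add: Q2 tcost_def)
  finally show ?thesis using coup by blast
qed

section \<open>The Wasserstein distance\<close>

text \<open>Convexity of the power is used for positive arguments only. When one argument is 0 the
  claim reduces to \<open>s powr p \<le> s\<close> for 0 < s < 1, which is where
  \<open>p \<ge> 1\<close> enters.\<close>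

lemma powr_convex_nonneg:
  fixes u v t p :: real
  assumes "p \<ge> 1" "0 < t" "t < 1" "u \<ge> 0" "v \<ge> 0"
  shows "(t * u + (1 - t) * v) powr p \<le> t * u powr p + (1 - t) * v powr p"
proof -
  have le: "(s * w) powr p \<le> s * w powr p" if "0 < s" "s < 1" "w \<ge> 0" for s w :: real
  proof -
    have "s powr p \<le> s powr 1" using that assms by (intro powr_mono') auto
    then show ?thesis using that by (simp add: powr_mult mult_right_mono)
  qed
  consider "u = 0" | "v = 0" | "u > 0" "v > 0" using assms by linarith
  then show ?thesis
  proof cases
    case 1
    then show ?thesis using le[of "1 - t" v] assms by simp
  next
    case 2
    then show ?thesis using le[of t u] assms by simp
  next
    case 3
    then show ?thesis
      using convex_onD[OF powr_convex[OF assms(1)], of "1 - t" u v] assms by simp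
  qed
qed

text \<open>Jensen's inequality for three points with weights proportional to \<open>K\<close>,
  \<open>L\<close>, \<open>e\<close>, by nesting two-point convexity. It replaces Minkowski's
  inequality in the proof of the triangle inequality.\<close>

lemma powr_add3_le:
  fixes K L e a b c p :: real
  assumes p: "p \<ge> 1" and pos: "K > 0" "L > 0" "e > 0" and nonneg: "a \<ge> 0" "b \<ge> 0" "c \<ge> 0"
  shows "((a + b + c) / (K + L + e)) powr p \<le>
      K / (K + L + e) * (a / K) powr p + L / (K + L + e) * (b / L) powr p + e / (K + L + e) * (c / e) powr p"
proof -
  define S where "S = K + L + e"
  define t where "t = (K + L) / S"
  have S: "S > 0" using pos by (simp add: S_def)
  have t: "0 < t" "t < 1" using pos by (auto simp: t_def S_def)
  have t1: "1 - t = e / S" using S by (simp add: t_def S_def field_simps)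
  define r where "r = K / (K + L)"
  have r: "0 < r" "r < 1" using pos by (auto simp: r_def)
  have r1: "1 - r = L / (K + L)" using pos by (simp add: r_def field_simps)
  have "r * (a / K) + (1 - r) * (b / L) = (a + b) / (K + L)"
    unfolding r1 using pos by (simp add: r_def add_divide_distrib)
  then have ab: "((a + b) / (K + L)) powr p \<le> r * (a / K) powr p + (1 - r) * (b / L) powr p"
    using powr_convex_nonneg[OF p r, of "a / K" "b / L"] pos nonneg by simp
  have "t * ((a + b) / (K + L)) + (1 - t) * (c / e) = (a + b + c) / S"
  proof -
    have "t * ((a + b) / (K + L)) = (a + b) / S" using pos by (simp add: t_def)
    moreover have "(1 - t) * (c / e) = c / S" unfolding t1 using pos by simp
    ultimately show ?thesis by (simp add: add_divide_distrib)
  qed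
  then have "((a + b + c) / S) powr p \<le> t * ((a + b) / (K + L)) powr p + (1 - t) * (c / e) powr p"
    using powr_convex_nonneg[OF p t, of "(a + b) / (K + L)" "c / e"] pos nonneg by simp
  also have "\<dots> \<le> t * (r * (a / K) powr p + (1 - r) * (b / L) powr p) + (1 - t) * (c / e) powr p"
    using ab t by (intro add_right_mono mult_left_mono) auto
  also have "\<dots> = (t * r) * (a / K) powr p + (t * (1 - r)) * (b / L) powr p + (1 - t) * (c / e) powr p"
    by (simp add: algebra_simps)
  also have "t * r = K / S" using pos by (simp add: t_def r_def)
  also have "t * (1 - r) = L / S" unfolding r1 using pos by (simp add: t_def)
  finally show ?thesis unfolding t1 unfolding S_def .
qed

section \<open>Finite transport cost and moment bounds for couplings\<close>

lemma product_coupling: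
  fixes q :: "nat \<Rightarrow> 'a::metric_space" and \<mu> \<nu> :: "'a measure"
  assumes dense: "\<And>x e. e > 0 \<Longrightarrow> \<exists>n. dist x (q n) < e"
    and \<mu>: "prob_space \<mu>" "sets \<mu> = sets borel" and \<nu>: "prob_space \<nu>" "sets \<nu> = sets borel"
  shows "distr (\<mu> \<Otimes>\<^sub>M \<nu>) borel (\<lambda>z. (fst z, snd z)) \<in> couplings \<mu> \<nu>"
proof -
  interpret mu: prob_space \<mu> by fact
  interpret nu: prob_space \<nu> by fact
  interpret pair_prob_space \<mu> \<nu> by standard
  have f: "fst \<in> borel_measurable (\<mu> \<Otimes>\<^sub>M \<nu>)" and s: "snd \<in> borel_measurable (\<mu> \<Otimes>\<^sub>M \<nu>)"
    using measurable_fst[of \<mu> \<nu>] measurable_snd[of \<mu> \<nu>] measurable_cong_sets[OF refl \<mu>(2)]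
      measurable_cong_sets[OF refl \<nu>(2)] by blast+
  \<comment> \<open>The map is the identity on pairs; its image measure only passes from the product
    of the two sigma-algebras to the Borel sets of the product space.\<close>
  have h: "(\<lambda>z. (fst z, snd z)) \<in> borel_measurable (\<mu> \<Otimes>\<^sub>M \<nu>)"
    by (intro borel_measurable_Pair_dense[OF dense dense] f s)
  let ?\<pi> = "distr (\<mu> \<Otimes>\<^sub>M \<nu>) borel (\<lambda>z. (fst z, snd z))"
  have "distr ?\<pi> borel fst = distr (\<mu> \<Otimes>\<^sub>M \<nu>) borel fst"
    using h by (subst distr_distr) (auto simp: measurable_fst_borel comp_def)
  also have "\<dots> = distr (\<mu> \<Otimes>\<^sub>M \<nu>) \<mu> fst"
    using \<mu>(2) by (intro distr_cong) auto
  also have "\<dots> = \<mu>" by (rule nu.distr_pair_fst)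
  finally have 1: "distr ?\<pi> borel fst = \<mu>" .
  have "distr ?\<pi> borel snd = distr (\<mu> \<Otimes>\<^sub>M \<nu>) borel snd"
    using h by (subst distr_distr) (auto simp: measurable_snd_borel comp_def)
  also have "\<dots> = distr (\<mu> \<Otimes>\<^sub>M \<nu>) \<nu> snd"
    using \<nu>(2) by (intro distr_cong) auto
  also have "\<dots> = \<nu>"
  proof (rule measure_eqI)
    fix A assume "A \<in> sets (distr (\<mu> \<Otimes>\<^sub>M \<nu>) \<nu> snd)"
    then have A: "A \<in> sets \<nu>" by simp
    then have "snd -` A \<inter> space (\<mu> \<Otimes>\<^sub>M \<nu>) = space \<mu> \<times> A"
      using sets.sets_into_space by (auto simp: space_pair_measure)
    then show "emeasure (distr (\<mu> \<Otimes>\<^sub>M \<nu>) \<nu> snd) A = emeasure \<nu> A"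
      using A by (simp add: emeasure_distr nu.emeasure_pair_measure_Times mu.emeasure_space_1)
  qed simp
  finally have 2: "distr ?\<pi> borel snd = \<nu>" .
  show ?thesis
    using 1 2 prob_space_distr[OF h] by (simp add: couplings_def)
qed

lemma tcost_le_moments:
  fixes \<mu> \<nu> :: "'a::metric_space measure"
  assumes \<pi>: "\<pi> \<in> couplings \<mu> \<nu>" and p: "p \<ge> 0"
  shows "tcost p \<pi> \<le> ennreal (2 powr p) * (moment p x0 \<mu> + moment p x0 \<nu>)"
proof -
  note D = couplingsD[OF \<pi>]
  have [measurable]: "(\<lambda>z. dist (fst z) x0 powr p) \<in> borel_measurable \<pi>"
    "(\<lambda>z. dist (snd z) x0 powr p) \<in> borel_measurable \<pi>"
    using measurable_compose[OF D(5) borel_measurable_dist_const_powr]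
      measurable_compose[OF D(6) borel_measurable_dist_const_powr] by auto
  have "tcost p \<pi> \<le> (\<integral>\<^sup>+ z. ennreal (2 powr p) * (ennreal (dist (fst z) x0 powr p) + ennreal (dist (snd z) x0 powr p)) \<partial>\<pi>)"
    unfolding tcost_def using dist_powr_le[OF p]
    by (intro nn_integral_mono) (simp flip: ennreal_mult ennreal_plus)
  also have "\<dots> = ennreal (2 powr p) * ((\<integral>\<^sup>+ z. ennreal (dist (fst z) x0 powr p) \<partial>\<pi>) + (\<integral>\<^sup>+ z. ennreal (dist (snd z) x0 powr p) \<partial>\<pi>))"
    by (simp add: nn_integral_cmult nn_integral_add)
  also have "\<dots> = ennreal (2 powr p) * (moment p x0 \<mu> + moment p x0 \<nu>)"
    unfolding moment_def using borel_measurable_dist_const_powr[of x0 p]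
    by (subst nn_integral_coupling(1)[OF \<pi>], simp, subst nn_integral_coupling(2)[OF \<pi>]) auto
  finally show ?thesis .
qed

text \<open>Finite cost to one fixed measure controls the moment of the other. This is how bounded
  distance to a reference measure becomes tightness.\<close>

lemma moment_le_tcost:
  fixes \<mu> \<nu> :: "'a::metric_space measure"
  assumes \<pi>: "\<pi> \<in> couplings \<mu> \<nu>" and p: "p \<ge> 0"
  shows "moment p x0 \<mu> \<le> ennreal (2 powr p) * (tcost p \<pi> + moment p x0 \<nu>)"
proof -
  note D = couplingsD[OF \<pi>]
  have [measurable]: "(\<lambda>z. dist (fst z) (snd z) powr p) \<in> borel_measurable \<pi>"
    "(\<lambda>z. dist (snd z) x0 powr p) \<in> borel_measurable \<pi>"
    using measurable_compose[OF D(6) borel_measurable_dist_const_powr]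
      borel_measurable_dist_powr[of p, where 'a='a] D(1) by (auto cong: measurable_cong_sets)
  have "moment p x0 \<mu> = (\<integral>\<^sup>+ z. ennreal (dist (fst z) x0 powr p) \<partial>\<pi>)"
    unfolding moment_def using borel_measurable_dist_const_powr[of x0 p]
    by (subst nn_integral_coupling(1)[OF \<pi>]) auto
  also have "\<dots> \<le> (\<integral>\<^sup>+ z. ennreal (2 powr p) * (ennreal (dist (fst z) (snd z) powr p) + ennreal (dist (snd z) x0 powr p)) \<partial>\<pi>)"
  proof (intro nn_integral_mono)
    fix z :: "'a \<times> 'a"
    show "ennreal (dist (fst z) x0 powr p) \<le> ennreal (2 powr p) * (ennreal (dist (fst z) (snd z) powr p) + ennreal (dist (snd z) x0 powr p))"
      using dist_powr_le[OF p, of "fst z" x0 "snd z"]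
      by (simp add: dist_commute flip: ennreal_mult ennreal_plus)
  qed
  also have "\<dots> = ennreal (2 powr p) * (tcost p \<pi> + (\<integral>\<^sup>+ z. ennreal (dist (snd z) x0 powr p) \<partial>\<pi>))"
    by (simp add: nn_integral_cmult nn_integral_add tcost_def)
  also have "(\<integral>\<^sup>+ z. ennreal (dist (snd z) x0 powr p) \<partial>\<pi>) = moment p x0 \<nu>"
    unfolding moment_def using borel_measurable_dist_const_powr[of x0 p]
    by (subst nn_integral_coupling(2)[OF \<pi>]) auto
  finally show ?thesis .
qed

text \<open>The product metric is at most the sum of the coordinate distances, so moment bounds on
  the marginals yield tightness of couplings.\<close>

lemma moment_coupling_le:
  fixes \<mu> \<nu> :: "'a::metric_space measure"
  assumes \<pi>: "\<pi> \<in> couplings \<mu> \<nu>" and p: "p \<ge> 0"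
  shows "moment p (x0, x0) \<pi> \<le> ennreal (2 powr p) * (moment p x0 \<mu> + moment p x0 \<nu>)"
proof -
  note D = couplingsD[OF \<pi>]
  have [measurable]: "(\<lambda>z. dist (fst z) x0 powr p) \<in> borel_measurable \<pi>"
    "(\<lambda>z. dist (snd z) x0 powr p) \<in> borel_measurable \<pi>"
    using measurable_compose[OF D(5) borel_measurable_dist_const_powr]
      measurable_compose[OF D(6) borel_measurable_dist_const_powr] by auto
  have "moment p (x0, x0) \<pi> \<le> (\<integral>\<^sup>+ z. ennreal (2 powr p) * (ennreal (dist (fst z) x0 powr p) + ennreal (dist (snd z) x0 powr p)) \<partial>\<pi>)"
    unfolding moment_def
  proof (intro nn_integral_mono)
    fix z :: "'a \<times> 'a"
    have "dist z (x0, x0) \<le> dist (fst z) x0 + dist (snd z) x0"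
      by (cases z) (simp add: dist_Pair_Pair sqrt_sum_squares_le_sum)
    then have "dist z (x0, x0) powr p \<le> (dist (fst z) x0 + dist (snd z) x0) powr p"
      using p by (intro powr_mono2) auto
    also have "\<dots> \<le> 2 powr p * (dist (fst z) x0 powr p + dist (snd z) x0 powr p)"
      using p by (intro powr_add_le) auto
    finally show "ennreal (dist z (x0, x0) powr p) \<le> ennreal (2 powr p) * (ennreal (dist (fst z) x0 powr p) + ennreal (dist (snd z) x0 powr p))"
      by (simp flip: ennreal_mult ennreal_plus)
  qed
  also have "\<dots> = ennreal (2 powr p) * ((\<integral>\<^sup>+ z. ennreal (dist (fst z) x0 powr p) \<partial>\<pi>) + (\<integral>\<^sup>+ z. ennreal (dist (snd z) x0 powr p) \<partial>\<pi>))"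
    by (simp add: nn_integral_cmult nn_integral_add)
  also have "\<dots> = ennreal (2 powr p) * (moment p x0 \<mu> + moment p x0 \<nu>)"
    unfolding moment_def using borel_measurable_dist_const_powr[of x0 p]
    by (subst nn_integral_coupling(1)[OF \<pi>], simp, subst nn_integral_coupling(2)[OF \<pi>]) auto
  finally show ?thesis .
qed

lemma Wpp_finite:
  fixes q :: "nat \<Rightarrow> 'a::metric_space" and \<mu> \<nu> :: "'a measure"
  assumes dense: "\<And>x e. e > 0 \<Longrightarrow> \<exists>n. dist x (q n) < e" and p: "p \<ge> 0"
    and \<mu>: "\<mu> \<in> Wspace p" and \<nu>: "\<nu> \<in> Wspace p"
  shows "Wpp p \<mu> \<nu> < \<infinity>"
proof -
  note M = WspaceD[OF \<mu> p] and N = WspaceD[OF \<nu> p]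
  let ?\<pi> = "distr (\<mu> \<Otimes>\<^sub>M \<nu>) borel (\<lambda>z. (fst z, snd z))"
  have \<pi>: "?\<pi> \<in> couplings \<mu> \<nu>" using M N by (intro product_coupling[OF dense])
  have "Wpp p \<mu> \<nu> \<le> tcost p ?\<pi>" by (rule Wpp_le_tcost[OF \<pi>])
  also have "\<dots> \<le> ennreal (2 powr p) * (moment p (q 0) \<mu> + moment p (q 0) \<nu>)"
    by (rule tcost_le_moments[OF \<pi> p])
  also have "\<dots> < \<infinity>" using M(3)[of "q 0"] N(3)[of "q 0"] by (simp add: ennreal_mult_less_top less_top)
  finally show ?thesis .
qed

text \<open>\<open>Wdist\<close> passes through \<open>enn2real\<close>, which sends infinity to 0;
  finiteness of the cost is what makes the p-th power recover \<open>Wpp\<close>.\<close>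

lemma Wpp_eq_Wdist:
  fixes q :: "nat \<Rightarrow> 'a::metric_space" and \<mu> \<nu> :: "'a measure"
  assumes dense: "\<And>x e. e > 0 \<Longrightarrow> \<exists>n. dist x (q n) < e" and p: "p > 0"
    and \<mu>: "\<mu> \<in> Wspace p" and \<nu>: "\<nu> \<in> Wspace p"
  shows "ennreal (Wdist p \<mu> \<nu> powr p) = Wpp p \<mu> \<nu>"
  using Wpp_finite[OF dense _ \<mu> \<nu>] p by (simp add: Wdist_def powr_powr)

lemma Wdist_less_coupling:
  fixes q :: "nat \<Rightarrow> 'a::metric_space" and \<mu> \<nu> :: "'a measure"
  assumes dense: "\<And>x e. e > 0 \<Longrightarrow> \<exists>n. dist x (q n) < e" and p: "p > 0"
    and \<mu>: "\<mu> \<in> Wspace p" and \<nu>: "\<nu> \<in> Wspace p" and K: "Wdist p \<mu> \<nu> < K"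
  obtains \<pi> where "\<pi> \<in> couplings \<mu> \<nu>" "tcost p \<pi> < ennreal (K powr p)"
proof -
  have "Wpp p \<mu> \<nu> < ennreal (K powr p)"
    using K p Wdist_nonneg[of p \<mu> \<nu>]
    by (subst Wpp_eq_Wdist[OF dense p \<mu> \<nu>, symmetric]) (auto intro!: ennreal_lessI powr_less_mono2 simp: order_le_less_trans)
  then show ?thesis using that unfolding Wpp_tcost INF_less_iff by blast
qed

text \<open>Couplings with costs below \<open>K powr p\<close> and \<open>L powr p\<close> are glued
  up to an error \<open>e\<close> in the middle point. Convexity after division by
  \<open>S = K + L + e\<close> bounds the cost of the result by \<open>S powr p\<close>.\<close>

lemma Wdist_triangle:
  fixes q :: "nat \<Rightarrow> 'a::metric_space" and \<mu> \<nu> \<rho> :: "'a measure"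
  assumes dense: "\<And>x e. e > 0 \<Longrightarrow> \<exists>n. dist x (q n) < e" and p: "p \<ge> 1"
    and \<mu>: "\<mu> \<in> Wspace p" and \<nu>: "\<nu> \<in> Wspace p" and \<rho>: "\<rho> \<in> Wspace p"
  shows "Wdist p \<mu> \<rho> \<le> Wdist p \<mu> \<nu> + Wdist p \<nu> \<rho>"
proof (rule field_le_epsilon)
  fix e0 :: real assume "e0 > 0"
  \<comment> \<open>The slack is spent three times: in \<open>K\<close>, in \<open>L\<close> and in
    the gluing error. It also keeps \<open>K\<close> and \<open>L\<close> positive when a distance
    vanishes.\<close>
  define e where "e = e0 / 3"
  have e: "e > 0" using \<open>e0 > 0\<close> by (simp add: e_def)
  define K where "K = Wdist p \<mu> \<nu> + e"
  define L where "L = Wdist p \<nu> \<rho> + e"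
  define S where "S = K + L + e"
  have pos: "K > 0" "L > 0" using e Wdist_nonneg[of p \<mu> \<nu>] Wdist_nonneg[of p \<nu> \<rho>] by (auto simp: K_def L_def)
  then have S: "S > 0" using e by (simp add: S_def)
  have p0: "p > 0" using p by simp
  obtain \<pi>1 where \<pi>1: "\<pi>1 \<in> couplings \<mu> \<nu>" "tcost p \<pi>1 < ennreal (K powr p)"
    using e by (rule_tac Wdist_less_coupling[OF dense p0 \<mu> \<nu>, of K]) (auto simp: K_def)
  obtain \<pi>2 where \<pi>2: "\<pi>2 \<in> couplings \<nu> \<rho>" "tcost p \<pi>2 < ennreal (L powr p)"
    using e by (rule_tac Wdist_less_coupling[OF dense p0 \<nu> \<rho>, of L]) (auto simp: L_def)
  \<comment> \<open>The coefficients are those of \<open>powr_add3_le\<close> multiplied by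
    \<open>S powr p\<close>. At costs \<open>K powr p\<close> and \<open>L powr p\<close> they add
    up to \<open>S powr p * ((K + e + L) / S) = S powr p\<close>.\<close>
  define A where "A = S powr p * (K / S) / K powr p"
  define B where "B = S powr p * (e / S)"
  define C where "C = S powr p * (L / S) / L powr p"
  have nonneg: "A \<ge> 0" "B \<ge> 0" "C \<ge> 0" using pos S e by (auto simp: A_def B_def C_def)
  have ineq: "dist x z powr p \<le> A * dist x y powr p + B + C * dist y' z powr p"
    if yy: "dist y y' < e" for x y y' z :: 'a
  proof -
    have "dist x z \<le> dist x y + dist y' z + dist y y'"
      using dist_triangle[of x z y] dist_triangle[of y z y'] by linarith
    then have "dist x z powr p \<le> (dist x y + dist y' z + dist y y') powr p"
      using p by (intro powr_mono2) auto
    also have "\<dots> = S powr p * ((dist x y + dist y' z + dist y y') / S) powr p"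
      using S by (simp add: powr_divide)
    also have "\<dots> \<le> S powr p * (K / S * (dist x y / K) powr p + L / S * (dist y' z / L) powr p + e / S * (dist y y' / e) powr p)"
      unfolding S_def using p pos e by (intro mult_left_mono powr_add3_le) auto
    also have "\<dots> \<le> S powr p * (K / S * (dist x y / K) powr p + L / S * (dist y' z / L) powr p + e / S * 1)"
    proof -
      have "(dist y y' / e) powr p \<le> 1 powr p"
        using yy e p by (intro powr_mono2) auto
      then show ?thesis using S e by (intro mult_left_mono add_left_mono) auto
    qed
    also have "\<dots> = A * dist x y powr p + B + C * dist y' z powr p"
      using pos S by (simp add: A_def B_def C_def powr_divide algebra_simps)
    finally show ?thesis .
  qed
  obtain \<pi> where \<pi>: "\<pi> \<in> couplings \<mu> \<rho>" "tcost p \<pi> \<le> ennreal A * tcost p \<pi>1 + ennreal B + ennreal C * tcost p \<pi>2"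
    using approximate_gluing[OF dense \<pi>1(1) \<pi>2(1) e nonneg ineq] by blast
  note \<pi>(2)
  also have "ennreal A * tcost p \<pi>1 + ennreal B + ennreal C * tcost p \<pi>2 \<le>
      ennreal A * ennreal (K powr p) + ennreal B + ennreal C * ennreal (L powr p)"
    using \<pi>1(2) \<pi>2(2) by (intro add_mono mult_left_mono) auto
  also have "\<dots> = ennreal (A * K powr p + B + C * L powr p)"
    using nonneg by (simp add: ennreal_mult ennreal_plus)
  also have "A * K powr p + B + C * L powr p = S powr p * ((K + e + L) / S)"
    using pos S by (simp add: A_def B_def C_def add_divide_distrib algebra_simps)
  also have "\<dots> = S powr p" using S by (simp add: S_def algebra_simps)
  finally have "Wpp p \<mu> \<rho> \<le> ennreal (S powr p)"
    using Wpp_le_tcost[OF \<pi>(1), of p] by simp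
  then have "Wdist p \<mu> \<rho> powr p \<le> S powr p"
    using Wpp_eq_Wdist[OF dense p0 \<mu> \<rho>] by (metis ennreal_le_iff powr_ge_zero)
  then have "Wdist p \<mu> \<rho> \<le> S"
    using p0 S Wdist_nonneg[of p \<mu> \<rho>] by (metis leD linorder_not_less order_less_imp_le powr_less_mono2)
  then show "Wdist p \<mu> \<rho> \<le> Wdist p \<mu> \<nu> + Wdist p \<nu> \<rho> + e0"
    by (simp add: S_def K_def L_def e_def)
qed

section \<open>Weak limits\<close>

lemma weak_lim_subseq:
  assumes "weak_lim Ms M" "strict_mono r"
  shows "weak_lim (Ms \<circ> r) M"
  unfolding weak_lim_def
proof (intro allI impI)
  fix f :: "'a \<Rightarrow> real" assume "continuous_on UNIV f" "\<exists>B. \<forall>x. \<bar>f x\<bar> \<le> B"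
  then have "(\<lambda>n. \<integral>x. f x \<partial>(Ms n)) \<longlonglongrightarrow> (\<integral>x. f x \<partial>M)"
    using assms(1) unfolding weak_lim_def by blast
  from LIMSEQ_subseq_LIMSEQ[OF this assms(2)]
  show "(\<lambda>n. \<integral>x. f x \<partial>((Ms \<circ> r) n)) \<longlonglongrightarrow> (\<integral>x. f x \<partial>M)" by (simp add: o_def)
qed

lemma weak_lim_const: "weak_lim (\<lambda>_. M) M"
  by (simp add: weak_lim_def)

text \<open>The functions \<open>max 0 (1 - k * infdist x F)\<close> decrease to the indicator of a
  closed nonempty \<open>F\<close>, so their integrals determine the measure on closed sets, an
  intersection-stable generator of the Borel sets.\<close>

lemma measure_eqI_continuous:
  fixes M N :: "'a::metric_space measure"
  assumes M: "prob_space M" "sets M = sets borel" and N: "prob_space N" "sets N = sets borel"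
    and eq: "\<And>f :: 'a \<Rightarrow> real. continuous_on UNIV f \<Longrightarrow> \<exists>B. \<forall>x. \<bar>f x\<bar> \<le> B \<Longrightarrow> (\<integral>x. f x \<partial>M) = (\<integral>x. f x \<partial>N)"
  shows "M = N"
proof (rule measure_eqI_generator_eq[of "Collect closed" UNIV M N "\<lambda>_. UNIV"])
  interpret M: prob_space M by fact
  interpret N: prob_space N by fact
  have lim: "(\<lambda>k. \<integral>x. max 0 (1 - real k * infdist x F) \<partial>L) \<longlonglongrightarrow> measure L F"
    if L: "prob_space L" "sets L = sets borel" and F: "closed F" "F \<noteq> {}" for L :: "'a measure" and F
  proof -
    interpret L: prob_space L by fact
    have Fs: "F \<in> sets L" using F L by auto
    have "(\<lambda>k. \<integral>x. max 0 (1 - real k * infdist x F) \<partial>L) \<longlonglongrightarrow> (\<integral>x. indicator F x \<partial>L)"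
    proof (rule integral_dominated_convergence[where w="\<lambda>_. 1"])
      show "(\<lambda>x. max 0 (1 - real k * infdist x F)) \<in> borel_measurable L" for k
      proof -
        have "(\<lambda>x. max 0 (1 - real k * infdist x F)) \<in> borel_measurable borel"
          by (intro borel_measurable_continuous_onI continuous_intros)
        then show ?thesis using L(2) by (simp cong: measurable_cong_sets)
      qed
      show "AE x in L. (\<lambda>k. max 0 (1 - real k * infdist x F)) \<longlonglongrightarrow> indicator F x"
      proof (rule AE_I2)
        fix x
        show "(\<lambda>k. max 0 (1 - real k * infdist x F)) \<longlonglongrightarrow> indicator F x"
        proof (cases "x \<in> F")
          case True
          then show ?thesis by simp
        next
          case False
          then have pos: "infdist x F > 0"
            using F infdist_pos_not_in_closed by blast
          obtain k0 :: nat where k0: "1 / infdist x F < real k0" using reals_Archimedean2 by blast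
          have "max 0 (1 - real k * infdist x F) = 0" if "k \<ge> k0" for k
          proof -
            have "1 < real k0 * infdist x F" using k0 pos by (simp add: field_simps)
            also have "\<dots> \<le> real k * infdist x F" using that pos by (intro mult_right_mono) auto
            finally show ?thesis by simp
          qed
          then show ?thesis using False
            by (intro tendsto_eventually) (auto simp: eventually_sequentially)
        qed
      qed
      show "AE x in L. norm (max 0 (1 - real k * infdist x F)) \<le> 1" for k
        by (auto simp: infdist_nonneg)
    qed (use Fs in auto)
    then show ?thesis using Fs by simp
  qed
  show "emeasure M F = emeasure N F" if "F \<in> Collect closed" for F
  \<comment> \<open>The empty set is split off because \<open>infdist x {}\<close> is 0, so the test
    functions would be constantly 1.\<close>
  proof (cases "F = {}")
    case False
    have F: "closed F" using that by simp
    have "(\<integral>x. max 0 (1 - real k * infdist x F) \<partial>M) = (\<integral>x. max 0 (1 - real k * infdist x F) \<partial>N)" for k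
    proof (rule eq)
      show "continuous_on UNIV (\<lambda>x. max 0 (1 - real k * infdist x F))" by (intro continuous_intros)
      show "\<exists>B. \<forall>x. \<bar>max 0 (1 - real k * infdist x F)\<bar> \<le> B"
        by (intro exI[of _ 1]) (auto simp: infdist_nonneg)
    qed
    then have "measure M F = measure N F"
      using LIMSEQ_unique[OF lim[OF M F False]] lim[OF N F False] by simp
    then show ?thesis by (simp add: M.emeasure_eq_measure N.emeasure_eq_measure)
  qed simp
  show "Int_stable (Collect closed :: 'a set set)" by (auto simp: Int_stable_def)
  have "sets (borel :: 'a measure) = sigma_sets UNIV (Collect closed)"
    unfolding borel_eq_closed by (rule sets_measure_of) auto
  then show "sets M = sigma_sets UNIV (Collect closed)" "sets N = sigma_sets UNIV (Collect closed)"
    using M N by auto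
  show "emeasure M UNIV \<noteq> \<infinity>" by simp
qed auto

lemma weak_lim_unique:
  fixes M N :: "'a::metric_space measure"
  assumes M: "prob_space M" "sets M = sets borel" and N: "prob_space N" "sets N = sets borel"
    and "weak_lim Ms M" "weak_lim Ms N"
  shows "M = N"
proof (rule measure_eqI_continuous[OF M N])
  fix f :: "'a \<Rightarrow> real" assume "continuous_on UNIV f" "\<exists>B. \<forall>x. \<bar>f x\<bar> \<le> B"
  then show "(\<integral>x. f x \<partial>M) = (\<integral>x. f x \<partial>N)"
    using assms(5,6) LIMSEQ_unique unfolding weak_lim_def by blast
qed

lemma weak_lim_distr:
  fixes h :: "'a::metric_space \<Rightarrow> 'b::metric_space"
  assumes wl: "weak_lim Ms M" and h: "continuous_on UNIV h"
    and sets: "\<And>n. sets (Ms n) = sets borel" "sets M = sets borel"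
  shows "weak_lim (\<lambda>n. distr (Ms n) borel h) (distr M borel h)"
  unfolding weak_lim_def
proof (intro allI impI)
  fix f :: "'b \<Rightarrow> real" assume f: "continuous_on UNIV f" "\<exists>B. \<forall>x. \<bar>f x\<bar> \<le> B"
  have hm: "h \<in> borel_measurable N" if "sets N = sets borel" for N :: "'a measure"
    using borel_measurable_continuous_onI[OF h] that by (simp cong: measurable_cong_sets)
  have fm: "f \<in> borel_measurable borel" using f(1) by (rule borel_measurable_continuous_onI)
  have "continuous_on UNIV (\<lambda>x. f (h x))"
    using f(1) h by (auto intro: continuous_on_compose2)
  then have "(\<lambda>n. \<integral>x. f (h x) \<partial>(Ms n)) \<longlonglongrightarrow> (\<integral>x. f (h x) \<partial>M)"
    using wl f(2) unfolding weak_lim_def by blast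
  then show "(\<lambda>n. \<integral>x. f x \<partial>(distr (Ms n) borel h)) \<longlonglongrightarrow> (\<integral>x. f x \<partial>(distr M borel h))"
    by (simp add: integral_distr[OF hm fm] sets)
qed

text \<open>Semicontinuity for unbounded continuous integrands: the truncations
  \<open>min (h x) k\<close> pass to the weak limit, and Fatou's lemma in \<open>k\<close> removes
  the truncation. It is applied both to transport costs and to moments.\<close>

lemma weak_lim_nn_integral_le:
  fixes h :: "'a::metric_space \<Rightarrow> real" and C :: ennreal
  assumes wl: "weak_lim Ms M" and prob: "\<And>n. prob_space (Ms n)" "prob_space M"
    and sets: "\<And>n. sets (Ms n) = sets borel" "sets M = sets borel"
    and h: "continuous_on UNIV h" "\<And>x. h x \<ge> 0"
    and le: "\<And>n. (\<integral>\<^sup>+ x. ennreal (h x) \<partial>(Ms n)) \<le> c n" and c: "c \<longlonglongrightarrow> C"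
  shows "(\<integral>\<^sup>+ x. ennreal (h x) \<partial>M) \<le> C"
proof -
  define g where "g k x = min (h x) (real k)" for k :: nat and x
  have g_cont: "continuous_on UNIV (g k)" for k
    unfolding g_def by (intro continuous_intros h)
  have g_bound: "0 \<le> g k x" "g k x \<le> real k" "g k x \<le> h x" for k x using h(2) by (auto simp: g_def)
  have g_meas: "g k \<in> borel_measurable L" if "sets L = sets borel" for k and L :: "'a measure"
    using borel_measurable_continuous_onI[OF g_cont[of k]] that by (simp cong: measurable_cong_sets)
  have nn: "(\<integral>\<^sup>+ x. ennreal (g k x) \<partial>L) = ennreal (\<integral>x. g k x \<partial>L)"
    if L: "prob_space L" "sets L = sets borel" for k and L :: "'a measure"
  proof -
    interpret prob_space L by fact
    have "integrable L (g k)"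
      by (rule integrable_const_bound[of _ "real k"]) (use g_bound g_meas[OF L(2)] in auto)
    then show ?thesis by (rule nn_integral_eq_integral) (simp add: g_bound)
  qed
  have gC: "(\<integral>\<^sup>+ x. ennreal (g k x) \<partial>M) \<le> C" for k
  proof -
    have "(\<lambda>n. \<integral>x. g k x \<partial>(Ms n)) \<longlonglongrightarrow> (\<integral>x. g k x \<partial>M)"
    proof -
      have "\<exists>B. \<forall>x. \<bar>g k x\<bar> \<le> B" using g_bound by (intro exI[of _ "real k"]) auto
      then show ?thesis using wl g_cont unfolding weak_lim_def by blast
    qed
    then have "(\<lambda>n. ennreal (\<integral>x. g k x \<partial>(Ms n))) \<longlonglongrightarrow> ennreal (\<integral>x. g k x \<partial>M)"
      by (rule tendsto_ennrealI)
    then have "(\<lambda>n. (\<integral>\<^sup>+ x. ennreal (g k x) \<partial>(Ms n))) \<longlonglongrightarrow> (\<integral>\<^sup>+ x. ennreal (g k x) \<partial>M)"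
      by (simp add: nn prob sets)
    moreover have "(\<integral>\<^sup>+ x. ennreal (g k x) \<partial>(Ms n)) \<le> c n" for n
    proof -
      have "(\<integral>\<^sup>+ x. ennreal (g k x) \<partial>(Ms n)) \<le> (\<integral>\<^sup>+ x. ennreal (h x) \<partial>(Ms n))"
        using g_bound by (intro nn_integral_mono ennreal_leI) auto
      then show ?thesis using le[of n] by simp
    qed
    ultimately show ?thesis using c by (intro LIMSEQ_le) auto
  qed
  have "(\<integral>\<^sup>+ x. ennreal (h x) \<partial>M) = (\<integral>\<^sup>+ x. liminf (\<lambda>k. ennreal (g k x)) \<partial>M)"
  proof (intro nn_integral_cong)
    fix x
    obtain k0 :: nat where k0: "h x < real k0" using reals_Archimedean2 by blast
    have "(\<lambda>k. ennreal (g k x)) \<longlonglongrightarrow> ennreal (h x)"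
    proof (intro tendsto_eventually, unfold eventually_sequentially, intro exI[of _ k0] allI impI)
      fix k assume "k0 \<le> k"
      then have "h x \<le> real k" using k0 by (simp add: order.trans less_imp_le)
      then show "ennreal (g k x) = ennreal (h x)" by (simp add: g_def)
    qed
    then show "ennreal (h x) = liminf (\<lambda>k. ennreal (g k x))"
      by (simp add: lim_imp_Liminf)
  qed
  also have "\<dots> \<le> liminf (\<lambda>k. \<integral>\<^sup>+ x. ennreal (g k x) \<partial>M)"
    using g_meas[OF sets(2)] by (intro nn_integral_liminf) simp
  also have "\<dots> \<le> limsup (\<lambda>k. \<integral>\<^sup>+ x. ennreal (g k x) \<partial>M)"
    by (intro Liminf_le_Limsup) simp
  also have "\<dots> \<le> C" using gC by (intro Limsup_bounded) simp
  finally show ?thesis .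
qed

section \<open>Tightness from moments and limits of couplings\<close>

lemma tight_of_moment:
  fixes x0 :: "'b::metric_space" and Ms :: "nat \<Rightarrow> 'b measure"
  assumes p: "p > 0" and prob: "\<And>n. prob_space (Ms n)" and sets: "\<And>n. sets (Ms n) = sets borel"
    and mom: "\<And>n. moment p x0 (Ms n) \<le> K" and K: "K < \<infinity>" and \<epsilon>: "\<epsilon> > 0"
  shows "\<exists>R. \<forall>n. measure (Ms n) (cball x0 R) > 1 - \<epsilon>"
proof -
  obtain k where k: "K = ennreal k" "k \<ge> 0"
    using K by (cases K) auto
  \<comment> \<open>Markov's inequality bounds the mass outside the ball by
    \<open>k / R powr p = k / (k + 1) * \<epsilon>\<close>; the extra 1 makes this strictly less
    than \<epsilon> and keeps \<open>R\<close> positive.\<close>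
  define R where "R = ((k + 1) / \<epsilon>) powr (1 / p)"
  have Rp: "R powr p = (k + 1) / \<epsilon>" using k p \<epsilon> by (simp add: R_def powr_powr)
  have R: "R > 0" using k \<epsilon> by (simp add: R_def)
  have "measure (Ms n) (cball x0 R) > 1 - \<epsilon>" for n
  proof -
    interpret prob_space "Ms n" by (rule prob)
    have sp: "space (Ms n) = UNIV" using sets_eq_imp_space_eq[OF sets[of n]] by simp
    have cb: "cball x0 R \<in> sets (Ms n)" "- cball x0 R \<in> sets (Ms n)"
      using sets[of n] by (auto intro!: borel_closed borel_open)
    have "ennreal (R powr p * measure (Ms n) (- cball x0 R)) =
        (\<integral>\<^sup>+ x. ennreal (R powr p) * indicator (- cball x0 R) x \<partial>(Ms n))"
      using cb by (simp add: nn_integral_cmult_indicator emeasure_eq_measure ennreal_mult)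
    also have "\<dots> \<le> moment p x0 (Ms n)"
      unfolding moment_def
      using R p by (intro nn_integral_mono) (auto simp: indicator_def dist_commute intro!: ennreal_leI powr_mono2)
    also have "\<dots> \<le> ennreal k" using mom k by simp
    finally have "R powr p * measure (Ms n) (- cball x0 R) \<le> k" using k by simp
    then have "measure (Ms n) (- cball x0 R) \<le> k / (k + 1) * \<epsilon>"
      unfolding Rp using k \<epsilon> by (simp add: field_simps)
    also have "\<dots> < \<epsilon>" using k \<epsilon> by (simp add: field_simps)
    finally show ?thesis
      using prob_compl[OF cb(1)] sp by (simp add: Compl_eq_Diff_UNIV)
  qed
  then show ?thesis by blast
qed

text \<open>The moment bounds make the couplings tight on the product space, so a subsequence
  converges weakly. Projections are continuous and weak limits unique, which identifies the
  marginals, and the cost is lower semicontinuous.\<close>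

lemma coupling_limit:
  fixes q :: "nat \<Rightarrow> 'a::metric_space" and \<mu> \<nu> :: "'a measure"
  assumes proper: "\<And>x r. compact (cball (x::'a) r)"
    and dense: "\<And>x e. e > 0 \<Longrightarrow> \<exists>n. dist x (q n) < e" and p: "p > 0"
    and \<mu>: "prob_space \<mu>" "sets \<mu> = sets borel" "weak_lim \<mu>s \<mu>"
    and \<nu>: "prob_space \<nu>" "sets \<nu> = sets borel" "weak_lim \<nu>s \<nu>"
    and mom: "\<And>n. moment p x0 (\<mu>s n) \<le> K" "\<And>n. moment p x0 (\<nu>s n) \<le> K" "K < \<infinity>"
    and \<pi>s: "\<And>n. \<pi>s n \<in> couplings (\<mu>s n) (\<nu>s n)" "\<And>n. tcost p (\<pi>s n) \<le> c n" and c: "c \<longlonglongrightarrow> C"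
  shows "\<exists>\<pi>\<in>couplings \<mu> \<nu>. tcost p \<pi> \<le> C"
proof -
  note D = couplingsD[OF \<pi>s(1)]
  \<comment> \<open>The extraction takes place in \<open>'a \<times> 'a\<close>, so a dense sequence
    and compactness of closed balls must first be passed to the product.\<close>
  define q2 where "q2 n = (q (fst (prod_decode n)), q (snd (prod_decode n)))" for n
  have dense2: "\<exists>n. dist z (q2 n) < e" if e: "e > 0" for z :: "'a \<times> 'a" and e
  proof -
    obtain i where i: "dist (fst z) (q i) < e / 2" using dense[of "e/2" "fst z"] e by (meson half_gt_zero)
    obtain j where j: "dist (snd z) (q j) < e / 2" using dense[of "e/2" "snd z"] e by (meson half_gt_zero)
    have "dist z (q i, q j) \<le> dist (fst z) (q i) + dist (snd z) (q j)"
      by (cases z) (simp add: dist_Pair_Pair sqrt_sum_squares_le_sum)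
    then have "dist z (q2 (prod_encode (i, j))) < e" using i j by (simp add: q2_def)
    then show ?thesis by blast
  qed
  have proper2: "compact (cball z r)" for z :: "'a \<times> 'a" and r
  proof -
    have "cball z r \<subseteq> cball (fst z) r \<times> cball (snd z) r"
    proof
      fix w assume "w \<in> cball z r"
      then show "w \<in> cball (fst z) r \<times> cball (snd z) r"
        using dist_fst_le[of z w] dist_snd_le[of z w] by (simp add: mem_Times_iff)
    qed
    then have "cball z r = cball z r \<inter> (cball (fst z) r \<times> cball (snd z) r)" by auto
    moreover have "compact (cball (fst z) r \<times> cball (snd z) r)"
      by (intro compact_Times proper)
    ultimately show ?thesis by (metis closed_Int_compact closed_cball)
  qed
  have mom2: "moment p (x0, x0) (\<pi>s n) \<le> ennreal (2 powr p) * (K + K)" for n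
  proof -
    have "moment p (x0, x0) (\<pi>s n) \<le> ennreal (2 powr p) * (moment p x0 (\<mu>s n) + moment p x0 (\<nu>s n))"
      using p by (intro moment_coupling_le[OF \<pi>s(1)]) simp
    also have "\<dots> \<le> ennreal (2 powr p) * (K + K)" using mom by (intro mult_left_mono add_mono) auto
    finally show ?thesis .
  qed
  have fin: "ennreal (2 powr p) * (K + K) < \<infinity>" using mom(3) by (simp add: ennreal_mult_less_top less_top)
  have tight: "\<exists>R. \<forall>n. measure (\<pi>s n) (cball (x0, x0) R) > 1 - \<epsilon>" if "\<epsilon> > 0" for \<epsilon>
    by (rule tight_of_moment[OF p D(2) D(1) mom2 fin that])
  obtain r \<pi> where r: "strict_mono r" and \<pi>: "prob_space \<pi>" "sets \<pi> = sets borel" and wl: "weak_lim (\<pi>s \<circ> r) \<pi>"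
    by (rule prokhorov_proper[OF proper2 dense2 D(2) D(1) tight])
  have "distr \<pi> borel fst = \<mu>"
  proof (rule weak_lim_unique[of _ _ "\<mu>s \<circ> r"])
    have "weak_lim (\<lambda>n. distr ((\<pi>s \<circ> r) n) borel fst) (distr \<pi> borel fst)"
      using D(1) \<pi> by (intro weak_lim_distr wl continuous_intros) auto
    then show "weak_lim (\<mu>s \<circ> r) (distr \<pi> borel fst)" by (simp add: D(3) o_def)
    show "prob_space (distr \<pi> borel fst)"
      using \<pi> measurable_fst_borel by (intro prob_space.prob_space_distr) (auto cong: measurable_cong_sets)
  qed (use \<mu> weak_lim_subseq[OF \<mu>(3) r] in auto)
  moreover have "distr \<pi> borel snd = \<nu>"
  proof (rule weak_lim_unique[of _ _ "\<nu>s \<circ> r"])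
    have "weak_lim (\<lambda>n. distr ((\<pi>s \<circ> r) n) borel snd) (distr \<pi> borel snd)"
      using D(1) \<pi> by (intro weak_lim_distr wl continuous_intros) auto
    then show "weak_lim (\<nu>s \<circ> r) (distr \<pi> borel snd)" by (simp add: D(4) o_def)
    show "prob_space (distr \<pi> borel snd)"
      using \<pi> measurable_snd_borel by (intro prob_space.prob_space_distr) (auto cong: measurable_cong_sets)
  qed (use \<nu> weak_lim_subseq[OF \<nu>(3) r] in auto)
  ultimately have "\<pi> \<in> couplings \<mu> \<nu>" using \<pi> by (simp add: couplings_def)
  moreover have "tcost p \<pi> \<le> C"
    unfolding tcost_def
  proof (rule weak_lim_nn_integral_le[OF wl _ \<pi>(1) _ \<pi>(2)])
    show "continuous_on UNIV (\<lambda>z::'a \<times> 'a. dist (fst z) (snd z) powr p)"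
      using p by (intro continuous_on_powr' continuous_intros) auto
    show "(c \<circ> r) \<longlonglongrightarrow> C" using LIMSEQ_subseq_LIMSEQ[OF c r] .
    show "(\<integral>\<^sup>+ z. ennreal (dist (fst z) (snd z) powr p) \<partial>((\<pi>s \<circ> r) n)) \<le> (c \<circ> r) n" for n
      using \<pi>s(2)[of "r n"] by (simp add: tcost_def)
  qed (use D in auto)
  ultimately show ?thesis by blast
qed

lemma Wpp_approx_coupling:
  fixes q :: "nat \<Rightarrow> 'a::metric_space" and \<mu> \<nu> :: "'a measure"
  assumes dense: "\<And>x e. e > 0 \<Longrightarrow> \<exists>n. dist x (q n) < e" and p: "p \<ge> 0"
    and \<mu>: "\<mu> \<in> Wspace p" and \<nu>: "\<nu> \<in> Wspace p"
  shows "\<exists>\<pi>\<in>couplings \<mu> \<nu>. tcost p \<pi> \<le> Wpp p \<mu> \<nu> + ennreal (inverse (real (Suc n)))"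
proof -
  \<comment> \<open>Strictness depends on \<open>Wpp p \<mu> \<nu>\<close> being finite, since
    infinity would absorb the added term.\<close>
  have "Wpp p \<mu> \<nu> < Wpp p \<mu> \<nu> + ennreal (inverse (real (Suc n)))"
    using Wpp_finite[OF dense p \<mu> \<nu>] by (simp add: ennreal_add_left_cancel_less less_top)
  then show ?thesis unfolding Wpp_tcost INF_less_iff by (meson less_imp_le)
qed

lemma tendsto_add_inverse:
  fixes u :: "nat \<Rightarrow> ennreal"
  assumes "u \<longlonglongrightarrow> l"
  shows "(\<lambda>n. u n + ennreal (inverse (real (Suc n)))) \<longlonglongrightarrow> l"
proof -
  have "(\<lambda>n. ennreal (inverse (real (Suc n)))) \<longlonglongrightarrow> ennreal 0"
    by (intro tendsto_ennrealI LIMSEQ_inverse_real_of_nat)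
  from tendsto_add[OF assms this] show ?thesis by simp
qed

lemma Wpp_le_liminf:
  fixes q :: "nat \<Rightarrow> 'a::metric_space" and \<mu> \<nu> :: "'a measure"
  assumes proper: "\<And>x r. compact (cball (x::'a) r)"
    and dense: "\<And>x e. e > 0 \<Longrightarrow> \<exists>n. dist x (q n) < e" and p: "p > 0"
    and \<nu>: "prob_space \<nu>" "sets \<nu> = sets borel" "weak_lim \<nu>s \<nu>"
    and \<nu>s: "\<And>n. \<nu>s n \<in> Wspace p" "\<And>n. moment p x0 (\<nu>s n) \<le> K" "K < \<infinity>"
    and \<mu>: "\<mu> \<in> Wspace p"
  shows "Wpp p \<nu> \<mu> \<le> liminf (\<lambda>n. Wpp p (\<nu>s n) \<mu>)"
proof -
  have p0: "p \<ge> 0" using p by simp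
  \<comment> \<open>Along this subsequence the costs converge to the liminf itself, which supplies
    the convergent upper bound for \<open>coupling_limit\<close>.\<close>
  obtain s :: "nat \<Rightarrow> nat" where s: "strict_mono s"
    and lim: "((\<lambda>n. Wpp p (\<nu>s n) \<mu>) \<circ> s) \<longlonglongrightarrow> liminf (\<lambda>n. Wpp p (\<nu>s n) \<mu>)"
    using liminf_subseq_lim by blast
  have "\<exists>\<pi>\<in>couplings (\<nu>s (s n)) \<mu>. tcost p \<pi> \<le> Wpp p (\<nu>s (s n)) \<mu> + ennreal (inverse (real (Suc n)))" for n
    by (rule Wpp_approx_coupling[OF dense p0 \<nu>s(1) \<mu>])
  then obtain \<pi>s where \<pi>s: "\<And>n. \<pi>s n \<in> couplings (\<nu>s (s n)) \<mu>"
    "\<And>n. tcost p (\<pi>s n) \<le> Wpp p (\<nu>s (s n)) \<mu> + ennreal (inverse (real (Suc n)))"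
    by metis
  have c: "(\<lambda>n. Wpp p (\<nu>s (s n)) \<mu> + ennreal (inverse (real (Suc n)))) \<longlonglongrightarrow> liminf (\<lambda>n. Wpp p (\<nu>s n) \<mu>)"
    using tendsto_add_inverse[OF lim] by (simp add: o_def)
  note M = WspaceD[OF \<mu> p0]
  have "\<exists>\<pi>\<in>couplings \<nu> \<mu>. tcost p \<pi> \<le> liminf (\<lambda>n. Wpp p (\<nu>s n) \<mu>)"
  proof (rule coupling_limit[OF proper dense p \<nu>(1,2) _ M(2,1) weak_lim_const _ _ _ \<pi>s c])
    show "weak_lim (\<lambda>n. \<nu>s (s n)) \<nu>" using weak_lim_subseq[OF \<nu>(3) s] by (simp add: o_def)
    show "moment p x0 (\<nu>s (s n)) \<le> max K (moment p x0 \<mu>)" for n using \<nu>s(2)[of "s n"] by (simp add: le_max_iff_disj)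
    show "moment p x0 \<mu> \<le> max K (moment p x0 \<mu>)" by simp
    show "max K (moment p x0 \<mu>) < \<infinity>" using \<nu>s(3) M(3)[of x0] by simp
  qed
  then obtain \<pi> where "\<pi> \<in> couplings \<nu> \<mu>" "tcost p \<pi> \<le> liminf (\<lambda>n. Wpp p (\<nu>s n) \<mu>)" by blast
  then show ?thesis using Wpp_le_tcost[of \<pi> \<nu> \<mu> p] by simp
qed

text \<open>\<open>coupling_limit\<close> with constant marginals turns near-optimal couplings into
  one of cost exactly 0. It is concentrated on the diagonal, so its marginals coincide.\<close>

lemma Wpp_eq_0_imp_eq:
  fixes q :: "nat \<Rightarrow> 'a::metric_space" and \<mu> \<nu> :: "'a measure"
  assumes proper: "\<And>x r. compact (cball (x::'a) r)"
    and dense: "\<And>x e. e > 0 \<Longrightarrow> \<exists>n. dist x (q n) < e" and p: "p > 0"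
    and \<mu>: "\<mu> \<in> Wspace p" and \<nu>: "\<nu> \<in> Wspace p" and eq: "Wpp p \<mu> \<nu> = 0"
  shows "\<mu> = \<nu>"
proof -
  have p0: "p \<ge> 0" using p by simp
  note M = WspaceD[OF \<mu> p0] and N = WspaceD[OF \<nu> p0]
  have "\<exists>\<pi>\<in>couplings \<mu> \<nu>. tcost p \<pi> \<le> Wpp p \<mu> \<nu> + ennreal (inverse (real (Suc n)))" for n
    by (rule Wpp_approx_coupling[OF dense p0 \<mu> \<nu>])
  then obtain \<pi>s where \<pi>s: "\<And>n. \<pi>s n \<in> couplings \<mu> \<nu>"
    "\<And>n. tcost p (\<pi>s n) \<le> Wpp p \<mu> \<nu> + ennreal (inverse (real (Suc n)))"
    by metis
  have c: "(\<lambda>n. Wpp p \<mu> \<nu> + ennreal (inverse (real (Suc n)))) \<longlonglongrightarrow> 0"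
    unfolding eq by (rule tendsto_add_inverse) simp
  have "\<exists>\<pi>\<in>couplings \<mu> \<nu>. tcost p \<pi> \<le> 0"
  proof (rule coupling_limit[OF proper dense p M(2,1) weak_lim_const N(2,1) weak_lim_const _ _ _ \<pi>s c])
    let ?x0 = "q 0"
    show "moment p ?x0 \<mu> \<le> max (moment p ?x0 \<mu>) (moment p ?x0 \<nu>)" "moment p ?x0 \<nu> \<le> max (moment p ?x0 \<mu>) (moment p ?x0 \<nu>)"
      by simp_all
    show "max (moment p ?x0 \<mu>) (moment p ?x0 \<nu>) < \<infinity>" using M(3)[of ?x0] N(3)[of ?x0] by simp
  qed
  then obtain \<pi> where \<pi>: "\<pi> \<in> couplings \<mu> \<nu>" "tcost p \<pi> = 0" by auto
  note D = couplingsD[OF \<pi>(1)]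
  have "(\<lambda>z. ennreal (dist (fst z) (snd z) powr p)) \<in> borel_measurable \<pi>"
    using borel_measurable_dist_powr[of p, where 'a='a] D(1) by (auto cong: measurable_cong_sets)
  then have "AE z in \<pi>. ennreal (dist (fst z) (snd z) powr p) = 0"
    using \<pi>(2) unfolding tcost_def by (simp add: nn_integral_0_iff_AE)
  then have "AE z in \<pi>. fst z = snd z" by eventually_elim auto
  then have "distr \<pi> borel fst = distr \<pi> borel snd"
    using D by (intro distr_cong_AE) auto
  then show ?thesis using D by simp
qed

lemma Wpp_self:
  fixes \<mu> :: "'a::metric_space measure"
  assumes \<mu>: "prob_space \<mu>" "sets \<mu> = sets borel"
  shows "Wpp p \<mu> \<mu> = 0"
proof -
  interpret prob_space \<mu> by fact
  have h0: "(\<lambda>x. (x, x)) \<in> borel_measurable (borel :: 'a measure)"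
    by (intro borel_measurable_continuous_onI continuous_intros)
  then have h: "(\<lambda>x. (x, x)) \<in> borel_measurable \<mu>"
    using \<mu>(2) by (simp cong: measurable_cong_sets)
  let ?\<pi> = "distr \<mu> borel (\<lambda>x. (x, x))"
  have "distr \<mu> borel (\<lambda>x. x) = \<mu>"
    using \<mu>(2) distr_id2[of borel \<mu>] by simp
  then have "distr ?\<pi> borel fst = \<mu>" "distr ?\<pi> borel snd = \<mu>"
    using h by (subst distr_distr; simp add: measurable_fst_borel measurable_snd_borel comp_def)+
  then have \<pi>: "?\<pi> \<in> couplings \<mu> \<mu>"
    using prob_space_distr[OF h] by (simp add: couplings_def)
  have "tcost p ?\<pi> = 0"
    unfolding tcost_def using h borel_measurable_dist_powr[of p, where 'a='a]
    by (subst nn_integral_distr) auto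
  then show ?thesis using Wpp_le_tcost[OF \<pi>, of p] by simp
qed

section \<open>Existence of barycenters\<close>

lemma Metric_space_Wdist:
  fixes q :: "nat \<Rightarrow> 'a::metric_space"
  assumes proper: "\<And>x r. compact (cball (x::'a) r)"
    and dense: "\<And>x e. e > 0 \<Longrightarrow> \<exists>n. dist x (q n) < e" and p: "p \<ge> 1"
  shows "Metric_space (Wspace p :: 'a measure set) (Wdist p)"
proof
  fix \<mu> \<nu> :: "'a measure"
  show "0 \<le> Wdist p \<mu> \<nu>" by (rule Wdist_nonneg)
  show "Wdist p \<mu> \<nu> = Wdist p \<nu> \<mu>" by (rule Wdist_commute)
next
  fix \<mu> \<nu> :: "'a measure" assume \<mu>: "\<mu> \<in> Wspace p" and \<nu>: "\<nu> \<in> Wspace p"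
  have p0: "p > 0" using p by simp
  show "(Wdist p \<mu> \<nu> = 0) = (\<mu> = \<nu>)"
  proof
    assume "Wdist p \<mu> \<nu> = 0"
    moreover have "ennreal (Wdist p \<mu> \<nu> powr p) = Wpp p \<mu> \<nu>"
      by (rule Wpp_eq_Wdist[OF dense p0 \<mu> \<nu>])
    ultimately have eq: "Wpp p \<mu> \<nu> = 0" by simp
    show "\<mu> = \<nu>" by (rule Wpp_eq_0_imp_eq[OF proper dense p0 \<mu> \<nu> eq])
  next
    assume "\<mu> = \<nu>"
    then show "Wdist p \<mu> \<nu> = 0"
      using WspaceD[OF \<nu>] p by (simp add: Wdist_def Wpp_self)
  qed
  fix \<rho> :: "'a measure" assume \<rho>: "\<rho> \<in> Wspace p"
  show "Wdist p \<mu> \<rho> \<le> Wdist p \<mu> \<nu> + Wdist p \<nu> \<rho>"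
    by (rule Wdist_triangle[OF dense p \<mu> \<nu> \<rho>])
qed

section \<open>Borel structure of the Wasserstein space\<close>

lemma sets_borel_of: "sets (borel_of X) = sigma_sets (topspace X) {U. openin X U}"
  unfolding borel_of_def by (rule sets_measure_of) (auto dest: openin_subset)

lemma space_borel_of: "space (borel_of X) = topspace X"
  unfolding borel_of_def by (rule space_measure_of) (auto dest: openin_subset)

text \<open>Strict sublevel sets of the distance to \<open>x\<close> are open balls. Equality of
  \<open>space P\<close> with the carrier lets pointwise estimates under the integral be restricted
  to it.\<close>

lemma (in Metric_space) borel_measurable_dist_borel_of:
  assumes "sets P = sets (borel_of mtopology)" "x \<in> M"
  shows "d x \<in> borel_measurable P" "space P = M"
proof -
  show sp: "space P = M" using sets_eq_imp_space_eq[OF assms(1)] by (simp add: space_borel_of)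
  show "d x \<in> borel_measurable P"
  proof (subst borel_measurable_iff_less, intro allI)
    fix a
    have "{w \<in> space P. d x w < a} = mball x a" using assms(2) by (auto simp: sp)
    then show "{w \<in> space P. d x w < a} \<in> sets P"
      unfolding assms(1) sets_borel_of by (auto intro: openin_mball)
  qed
qed

lemma dense_sequence:
  assumes "separable_space (euclidean :: 'a::metric_space topology)"
  obtains q :: "nat \<Rightarrow> 'a::metric_space" where "\<And>x e. e > 0 \<Longrightarrow> \<exists>n. dist x (q n) < e"
proof -
  obtain C :: "'a set" where C: "countable C" "closure C = UNIV"
    using assms unfolding separable_space_def by auto
  then have ne: "C \<noteq> {}" by auto
  have "\<exists>n. dist x (from_nat_into C n) < e" if e: "e > 0" for x e
  proof -
    have "x \<in> closure C" using C by simp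
    then obtain y where y: "y \<in> C" "dist y x < e" using e unfolding closure_approachable by blast
    then obtain n where "from_nat_into C n = y" using from_nat_into_surj[OF C(1)] by blast
    then show ?thesis using y by (auto simp: dist_commute)
  qed
  then show ?thesis by (rule that)
qed

theorem theorem1:
  fixes p :: real and P :: "'a::complete_space measure measure"
  assumes "p \<ge> 1"
    and "separable_space (euclidean :: 'a topology)"
    and "locally_compact_space (euclidean :: 'a topology)"
    and "geodesic_space TYPE('a)"
    and "P \<in> WWspace p"
  shows "\<exists>\<nu>. barycenter p P \<nu>"
proof -
  have p: "p > 0" "p \<ge> 0" using assms(1) by auto
  have proper: "compact (cball (x::'a) r)" for x r
    by (rule geodesic_compact_cball[OF assms(4,3)])
  obtain q :: "nat \<Rightarrow> 'a" where dense: "\<And>x e. e > 0 \<Longrightarrow> \<exists>n. dist x (q n) < e"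
    using dense_sequence[OF assms(2)] by blast
  interpret W: Metric_space "Wspace p :: 'a measure set" "Wdist p"
    by (rule Metric_space_Wdist[OF proper dense assms(1)])
  have setsP: "sets P = sets (borel_of W.mtopology)" and "prob_space P"
    using assms(5) by (auto simp: WWspace_def)
  interpret P: prob_space P by fact
  obtain \<mu>0 where \<mu>0: "\<mu>0 \<in> Wspace p" "(\<integral>\<^sup>+ \<mu>. ennreal (Wdist p \<mu> \<mu>0 powr p) \<partial>P) < \<infinity>"
    using assms(5) by (auto simp: WWspace_def)
  have spP: "space P = Wspace p"
    using W.borel_measurable_dist_borel_of(2)[OF setsP \<mu>0(1)] .
  have meas: "(\<lambda>\<mu>. Wdist p \<nu> \<mu> powr p) \<in> borel_measurable P" if "\<nu> \<in> Wspace p" for \<nu>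
    using W.borel_measurable_dist_borel_of(1)[OF setsP that] by measurable
  define J where "J \<nu> = (\<integral>\<^sup>+ \<mu>. ennreal (Wdist p \<nu> \<mu> powr p) \<partial>P)" for \<nu>
  define I where "I = (INF \<nu>\<in>Wspace p. J \<nu>)"
  have J\<mu>0: "J \<mu>0 < \<infinity>" using \<mu>0(2) unfolding J_def by (simp add: Wdist_commute)
  have I_le: "I \<le> J \<nu>" if "\<nu> \<in> Wspace p" for \<nu> unfolding I_def using that by (rule INF_lower)
  have I: "I < \<infinity>" using I_le[OF \<mu>0(1)] J\<mu>0 by simp
  have "\<exists>\<nu>\<in>Wspace p. J \<nu> \<le> I + ennreal (inverse (real (Suc n)))" for n
  proof -
    have "I < I + ennreal (inverse (real (Suc n)))"
      using I by (simp add: ennreal_add_left_cancel_less less_top)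
    then show ?thesis unfolding I_def INF_less_iff by (meson less_imp_le)
  qed
  then obtain \<nu>s where \<nu>s: "\<And>n. \<nu>s n \<in> Wspace p" "\<And>n. J (\<nu>s n) \<le> I + ennreal (inverse (real (Suc n)))"
    by metis
  note D = WspaceD[OF \<nu>s(1) p(2)]
  let ?x0 = "q 0"
  \<comment> \<open>The term \<open>I + 1\<close> bounds the objective along the whole minimizing
    sequence, as its excess is at most 1; \<open>2 powr p\<close> comes from
    \<open>powr_add_le\<close> after the triangle inequality.\<close>
  define B where "B = ennreal (2 powr p) * (I + 1 + J \<mu>0)"
  have B: "B < \<infinity>" using I J\<mu>0 by (simp add: B_def ennreal_mult_less_top less_top)
  have Wpp_le: "Wpp p (\<nu>s n) \<mu>0 \<le> B" for n
  proof -
    \<comment> \<open>A constant integrates to itself against the probability measure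
      \<open>P\<close>, which allows the random \<mu> to be inserted between \<open>\<nu>s n\<close>
      and \<open>\<mu>0\<close>.\<close>
    have "ennreal (Wdist p (\<nu>s n) \<mu>0 powr p) = (\<integral>\<^sup>+ \<mu>. ennreal (Wdist p (\<nu>s n) \<mu>0 powr p) \<partial>P)"
      by (simp add: P.emeasure_space_1)
    also have "\<dots> \<le> (\<integral>\<^sup>+ \<mu>. ennreal (2 powr p) * (ennreal (Wdist p (\<nu>s n) \<mu> powr p) + ennreal (Wdist p \<mu>0 \<mu> powr p)) \<partial>P)"
    proof (rule nn_integral_mono)
      fix \<mu> assume "\<mu> \<in> space P"
      then have \<mu>: "\<mu> \<in> Wspace p" by (simp add: spP)
      have "Wdist p (\<nu>s n) \<mu>0 \<le> Wdist p (\<nu>s n) \<mu> + Wdist p \<mu>0 \<mu>"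
        using W.triangle[OF \<nu>s(1) \<mu> \<mu>0(1)] by (simp add: Wdist_commute)
      then have "Wdist p (\<nu>s n) \<mu>0 powr p \<le> (Wdist p (\<nu>s n) \<mu> + Wdist p \<mu>0 \<mu>) powr p"
        using p by (intro powr_mono2) (auto simp: Wdist_nonneg)
      also have "\<dots> \<le> 2 powr p * (Wdist p (\<nu>s n) \<mu> powr p + Wdist p \<mu>0 \<mu> powr p)"
        using p by (intro powr_add_le) (auto simp: Wdist_nonneg)
      finally show "ennreal (Wdist p (\<nu>s n) \<mu>0 powr p) \<le> ennreal (2 powr p) * (ennreal (Wdist p (\<nu>s n) \<mu> powr p) + ennreal (Wdist p \<mu>0 \<mu> powr p))"
        by (simp flip: ennreal_mult ennreal_plus)
    qed
    also have "\<dots> = ennreal (2 powr p) * (J (\<nu>s n) + J \<mu>0)"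
      using meas[OF \<nu>s(1)[of n]] meas[OF \<mu>0(1)]
      by (simp add: J_def nn_integral_cmult nn_integral_add)
    also have "\<dots> \<le> B"
    proof -
      have "J (\<nu>s n) \<le> I + 1"
      proof -
        have "ennreal (inverse (real (Suc n))) \<le> ennreal 1"
          by (intro ennreal_leI) (simp add: field_simps)
        then show ?thesis using \<nu>s(2)[of n] by (metis add_left_mono ennreal_1 order_trans)
      qed
      then show ?thesis unfolding B_def by (intro mult_left_mono add_mono) auto
    qed
    finally have "ennreal (Wdist p (\<nu>s n) \<mu>0 powr p) \<le> B" .
    moreover have "ennreal (Wdist p (\<nu>s n) \<mu>0 powr p) = Wpp p (\<nu>s n) \<mu>0"
      by (rule Wpp_eq_Wdist[OF dense p(1) \<nu>s(1) \<mu>0(1)])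
    ultimately show ?thesis by simp
  qed
  \<comment> \<open>The 1 is the excess cost of the chosen coupling of \<open>\<nu>s n\<close> with
    \<open>\<mu>0\<close>, that is, the approximation error at index 0.\<close>
  define K where "K = ennreal (2 powr p) * (B + 1 + moment p ?x0 \<mu>0)"
  have K: "K < \<infinity>"
    using B WspaceD(3)[OF \<mu>0(1) p(2), of ?x0] by (simp add: K_def ennreal_mult_less_top less_top)
  have mom: "moment p ?x0 (\<nu>s n) \<le> K" for n
  proof -
    have "\<exists>\<pi>\<in>couplings (\<nu>s n) \<mu>0. tcost p \<pi> \<le> Wpp p (\<nu>s n) \<mu>0 + ennreal (inverse (real (Suc 0)))"
      by (rule Wpp_approx_coupling[OF dense p(2) \<nu>s(1) \<mu>0(1)])
    then obtain \<pi> where \<pi>: "\<pi> \<in> couplings (\<nu>s n) \<mu>0" "tcost p \<pi> \<le> Wpp p (\<nu>s n) \<mu>0 + 1" by auto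
    have "moment p ?x0 (\<nu>s n) \<le> ennreal (2 powr p) * (tcost p \<pi> + moment p ?x0 \<mu>0)"
      by (rule moment_le_tcost[OF \<pi>(1) p(2)])
    also have "\<dots> \<le> K"
      unfolding K_def using order_trans[OF \<pi>(2) add_right_mono[OF Wpp_le]]
      by (intro mult_left_mono add_mono) auto
    finally show ?thesis .
  qed
  have tight: "\<exists>R. \<forall>n. measure (\<nu>s n) (cball ?x0 R) > 1 - \<epsilon>" if "\<epsilon> > 0" for \<epsilon>
    by (rule tight_of_moment[OF p(1) D(2,1) mom K that])
  obtain r \<nu> where r: "strict_mono r" and \<nu>: "prob_space \<nu>" "sets \<nu> = sets borel" and wl: "weak_lim (\<nu>s \<circ> r) \<nu>"
    by (rule prokhorov_proper[OF proper dense D(2,1) tight])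
  \<comment> \<open>Weak convergence alone does not put the limit in \<open>Wspace p\<close>; the
    uniform moment bound survives by truncation and does.\<close>
  have "moment p ?x0 \<nu> \<le> K"
    unfolding moment_def
  proof (rule weak_lim_nn_integral_le[OF wl _ \<nu>(1) _ \<nu>(2)])
    show "continuous_on UNIV (\<lambda>x. dist x ?x0 powr p)"
      using p by (intro continuous_on_powr' continuous_intros) auto
    show "(\<integral>\<^sup>+ x. ennreal (dist x ?x0 powr p) \<partial>((\<nu>s \<circ> r) n)) \<le> K" for n
      using mom[of "r n"] by (simp add: moment_def)
  qed (use D in auto)
  then have \<nu>W: "\<nu> \<in> Wspace p"
    using K by (intro WspaceI[OF \<nu>(2,1)]) (rule le_less_trans)
  have lsc: "ennreal (Wdist p \<nu> \<mu> powr p) \<le> liminf (\<lambda>n. ennreal (Wdist p ((\<nu>s \<circ> r) n) \<mu> powr p))"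
    if \<mu>: "\<mu> \<in> Wspace p" for \<mu>
  proof -
    have eq: "ennreal (Wdist p \<rho> \<mu> powr p) = Wpp p \<rho> \<mu>" if "\<rho> \<in> Wspace p" for \<rho>
      by (rule Wpp_eq_Wdist[OF dense p(1) that \<mu>])
    have "Wpp p \<nu> \<mu> \<le> liminf (\<lambda>n. Wpp p ((\<nu>s \<circ> r) n) \<mu>)"
    proof (rule Wpp_le_liminf[OF proper dense p(1) \<nu> wl _ _ K \<mu>])
      show "moment p ?x0 ((\<nu>s \<circ> r) n) \<le> K" for n using mom by simp
    qed (use \<nu>s in auto)
    then show ?thesis using \<nu>s(1) \<nu>W by (simp add: eq)
  qed
  \<comment> \<open>Semicontinuity holds for each fixed \<mu> in \<open>space P\<close>; Fatou's
    lemma over \<open>P\<close> then carries it to the objective, whose values along the subsequence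
    tend to the infimum.\<close>
  have "J \<nu> \<le> (\<integral>\<^sup>+ \<mu>. liminf (\<lambda>n. ennreal (Wdist p ((\<nu>s \<circ> r) n) \<mu> powr p)) \<partial>P)"
    unfolding J_def by (intro nn_integral_mono lsc) (simp add: spP)
  also have "\<dots> \<le> liminf (\<lambda>n. J ((\<nu>s \<circ> r) n))"
    unfolding J_def using meas[OF \<nu>s(1)] by (intro nn_integral_liminf) simp
  also have "\<dots> \<le> liminf (\<lambda>n. I + ennreal (inverse (real (Suc (r n)))))"
    using \<nu>s(2) by (intro Liminf_mono always_eventually) simp
  also have "\<dots> = I"
  proof (rule lim_imp_Liminf)
    show "(\<lambda>n. I + ennreal (inverse (real (Suc (r n))))) \<longlonglongrightarrow> I"
      using LIMSEQ_subseq_LIMSEQ[OF tendsto_add_inverse[OF tendsto_const] r] by (simp add: o_def)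
  qed simp
  finally have "J \<nu> \<le> J \<nu>'" if "\<nu>' \<in> Wspace p" for \<nu>'
    using I_le[OF that] by simp
  then show ?thesis
    using \<nu>W unfolding barycenter_def J_def by blast
qed

end
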